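(* Let $V$ be a Banach space with a uniformly bounded action of a countable discrete group $\Gamma$, and let $\Sigma=(\sigma_i\colon\Gamma\to\mathrm{Isom}(V_i))_i$ be a sequence of maps with each $V_i$ a finite-dimensional Banach space. Then for any dynamically generating sequence $S$ in $V$ and any product norm $\rho$, $$\dim_\Sigma(V,\Gamma)=\mathrm{vdim}_\Sigma(S,\rho).$$
   Context: An action of $\Gamma$ on $V$ by bounded linear operators is uniformly bounded if the operator norms of the elements $g\in\Gamma$ are uniformly bounded. $\mathrm{Isom}(W)$ is the group of linear surjective isometries of a Banach space $W$; the maps $\sigma_i$ are not assumed to be homomorphisms. A dynamically generating sequence is a bounded sequence $S=(x_j)_{j=1}^\infty$ in $V$ with $\overline{\mathrm{span}}\{gx_j:g\in\Gamma,j\in\mathbb N\}=V$. A product norm is a norm $\rho$ on $\ell^\infty(\mathbb N)$ with $\rho(f)\le\rho(g)$ whenever $|f|\le|g|$ and which induces the topology of pointwise convergence on $\{f:\|f\|_\infty\le1\}$; set $\rho_{V_i}(f)=\rho((\|f(n)\|)_{n=1}^\infty)$ for $f\in\ell^\infty(\mathbb N,V_i)$. For a subset $A$ of a vector space with pseudonorm $\rho$ and $\varepsilon>0$, $d_\varepsilon(A,\rho)$ is the smallest dimension of a linear subspace $W$ such that for every $x\in A$ there is $w\in W$ with $\rho(x-w)<\varepsilon$. Below, $F$ ranges over finite subsets of $\Gamma$, $m$ over $\mathbb N$, and $\delta$ over positive reals. Triples are ordered by $(F,m,\delta)\le(F',m',\delta')$ if $F\subseteq F'$, $m\le m'$, $\delta'<\delta$.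 Definition of $\dim_\Sigma$: let $V_{F,m}=\mathrm{span}\{g_1\cdots g_kx_j: g_1,\dots,g_k\in F,\ 1\le j,k\le m\}$ and let $\mathrm{Hom}_\Gamma(S,F,m,\delta,\sigma_i)$ be the set of bounded linear maps $T\colon V_{F,m}\to V_i$ with $\|T\|\le1$ and $\|T(g_1\cdots g_kx_j)-\sigma_i(g_1)\cdots\sigma_i(g_k)T(x_j)\|<\delta$ for all $g_1,\dots,g_k\in F$, $1\le j,k\le m$ (here $F$ is taken to contain the identity $e$, so that $T(x_j)$ is defined; this does not affect limits over $(F,m,\delta)$). Define $\alpha_S(T)\in\ell^\infty(\mathbb N,V_i)$ by $\alpha_S(T)(n)=T(x_n)$ for $1\le n\le m$ and $\alpha_S(T)(n)=0$ for $n>m$. Then $$\dim_\Sigma(V,\Gamma)=\sup_{\varepsilon>0}\limsup_{(F,m,\delta)}\limsup_{i\to\infty}\frac1{\dim V_i}d_\varepsilon\big(\alpha_S(\mathrm{Hom}_\Gamma(S,F,m,\delta,\sigma_i)),\rho_{V_i}\big).$$ It is known that this does not depend on the choice of dynamically generating sequence $S$ or product norm $\rho$, and that replacing $\limsup_{(F,m,\delta)}$ by $\liminf_{(F,m,\delta)}$ gives the same number. Definition of $\mathrm{vdim}_\Sigma$: let $\mathrm{Vect}_\Gamma(S,F,m,\delta,\sigma_i)$ be the set of all $m$-tuples $(\xi_j)_{j=1}^m$ of vectors in $V_i$ such that for all scalars $c_{g_1,\dots,g_l,j}$ (indexed by $1\le l,j\le m$, $g_1,\dots,g_l\in F$) with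 $\sum|c_{g_1,\dots,g_l,j}|\le1$, $$\Big\|\sum c_{g_1,\dots,g_l,j}\,\sigma_i(g_1)\cdots\sigma_i(g_l)\xi_j\Big\|\le\delta+\Big\|\sum c_{g_1,\dots,g_l,j}\,g_1\cdots g_lx_j\Big\|,$$ all sums being over $1\le l,j\le m$ and $g_1,\dots,g_l\in F$. Regard such a tuple as an element of $\ell^\infty(\mathbb N,V_i)$ by extending by $0$. Set $$\mathrm{vdim}_\Sigma(S,F,m,\delta,\varepsilon,\rho)=\limsup_{i\to\infty}\frac1{\dim V_i}d_\varepsilon\big(\mathrm{Vect}_\Gamma(S,F,m,\delta,\sigma_i),\rho_{V_i}\big),$$ $$\mathrm{vdim}_\Sigma(S,\varepsilon,\rho)=\inf_{F,m,\delta}\mathrm{vdim}_\Sigma(S,F,m,\delta,\varepsilon,\rho),\qquad \mathrm{vdim}_\Sigma(S,\rho)=\sup_{\varepsilon>0}\mathrm{vdim}_\Sigma(S,\varepsilon,\rho).$$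
   Formalization: The infimum over (F,m,δ) in vdim_Σ(S,ε,ρ) is replaced by the liminf along the ordered triples (F,m,δ); with the plain infimum the claim fails, e.g. for Γ trivial, V=V_i the scalars and S=(0,1,0,…), where vdim is 0 but dim is 1. *)

theory Defs
  imports
    "HOL-Analysis.Analysis"
    "HOL-Algebra.Group_Action"
    "HOL-Library.Function_Algebras"
begin

text \<open>
  The scalar field is a type \<open>'k\<close> of sort \<open>{real_normed_field, euclidean_space}\<close>; up to isometric
  isomorphism this means the real or the complex numbers, and both are instances.  The Banach
  space \<open>V\<close> is a type of class \<open>banach\<close> with a compatible scalar multiplication by \<open>'k\<close>.  The spaces
  \<open>V\<^sub>i\<close> have varying dimensions, so each of them is given by a carrier \<open>U i\<close>, a finite-dimensional
  subspace of a common (unnormed) vector space \<open>'w\<close>, and a norm \<open>N i\<close> on that carrier.  Sequences are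
  indexed from 0, so the indices \<open>1 \<le> j \<le> m\<close> appear as \<open>j < m\<close>.
\<close>

locale banach_scaling = vector_space sV
  for sV :: "'k::{real_normed_field,euclidean_space} \<Rightarrow> 'v::banach \<Rightarrow> 'v" +
  assumes norm_scale: "norm (sV c v) = norm c * norm v"
    and scale_of_real: "sV (of_real r) v = r *\<^sub>R v"

definition norm_on :: "('k::real_normed_field \<Rightarrow> 'b::ab_group_add \<Rightarrow> 'b) \<Rightarrow> 'b set \<Rightarrow> ('b \<Rightarrow> real) \<Rightarrow> bool"
  where "norm_on sc A N \<longleftrightarrow>
    (\<forall>x\<in>A. 0 \<le> N x \<and> (N x = 0 \<longleftrightarrow> x = 0)) \<and>
    (\<forall>x\<in>A. \<forall>y\<in>A. N (x + y) \<le> N x + N y) \<and>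
    (\<forall>c. \<forall>x\<in>A. N (sc c x) = norm c * N x)"

locale fd_normed_space = vector_space sW
  for sW :: "'k::{real_normed_field,euclidean_space} \<Rightarrow> 'w::ab_group_add \<Rightarrow> 'w" +
  fixes U :: "'w set" and N :: "'w \<Rightarrow> real"
  assumes subspace_U: "subspace U"
    and finite_dim: "\<exists>B. finite B \<and> U = span B"
    and norm_N: "norm_on sW U N"

definition linear_on ::
    "('k \<Rightarrow> 'b::plus \<Rightarrow> 'b) \<Rightarrow> ('k \<Rightarrow> 'c::plus \<Rightarrow> 'c) \<Rightarrow> 'b set \<Rightarrow> 'c set \<Rightarrow> ('b \<Rightarrow> 'c) \<Rightarrow> bool"
  where "linear_on s1 s2 A B T \<longleftrightarrow>
    (\<forall>x\<in>A. T x \<in> B) \<and>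
    (\<forall>x\<in>A. \<forall>y\<in>A. T (x + y) = T x + T y) \<and>
    (\<forall>c. \<forall>x\<in>A. T (s1 c x) = s2 c (T x))"

definition surj_isometry :: "('k \<Rightarrow> 'w::plus \<Rightarrow> 'w) \<Rightarrow> 'w set \<Rightarrow> ('w \<Rightarrow> real) \<Rightarrow> ('w \<Rightarrow> 'w) \<Rightarrow> bool"
  where "surj_isometry sW U N T \<longleftrightarrow>
    linear_on sW sW U U T \<and> T ` U = U \<and> (\<forall>x\<in>U. N (T x) = N x)"

locale uniformly_bounded_action = group_action G UNIV act + banach_scaling sV
  for G :: "('g, 'm) monoid_scheme" (structure)
    and sV :: "'k::{real_normed_field,euclidean_space} \<Rightarrow> 'v::banach \<Rightarrow> 'v"
    and act :: "'g \<Rightarrow> 'v \<Rightarrow> 'v" +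
  assumes countable_group: "countable (carrier G)"
    and act_linear: "g \<in> carrier G \<Longrightarrow> Vector_Spaces.linear sV sV (act g)"
    and act_bounded: "\<exists>C. \<forall>g\<in>carrier G. \<forall>v. norm (act g v) \<le> C * norm v"

definition dynamically_generating ::
    "('g, 'm) monoid_scheme \<Rightarrow> ('k::field \<Rightarrow> 'v::real_normed_vector \<Rightarrow> 'v) \<Rightarrow> ('g \<Rightarrow> 'v \<Rightarrow> 'v) \<Rightarrow>
      (nat \<Rightarrow> 'v) \<Rightarrow> bool"
  where "dynamically_generating G sV act S \<longleftrightarrow>
    bounded (range S) \<and> closure (module.span sV {act g (S j) | g j. g \<in> carrier G}) = UNIV"


definition ell_inf :: "'b set \<Rightarrow> ('b \<Rightarrow> real) \<Rightarrow> (nat \<Rightarrow> 'b) set"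
  where "ell_inf U N = {f. (\<forall>n. f n \<in> U) \<and> (\<exists>C. \<forall>n. N (f n) \<le> C)}"

definition seq_scale :: "('k \<Rightarrow> 'b \<Rightarrow> 'b) \<Rightarrow> 'k \<Rightarrow> (nat \<Rightarrow> 'b) \<Rightarrow> nat \<Rightarrow> 'b"
  where "seq_scale sc c f = (\<lambda>n. sc c (f n))"

text \<open>
  The last conjunct equates two topologies on the unit ball, the one of the metric \<open>\<rho> (f - g)\<close> and
  that of pointwise convergence; \<open>openin (top_of_set _)\<close> refers to the product topology, which is the
  topology of the function type.
\<close>
definition product_norm :: "((nat \<Rightarrow> 'k::real_normed_field) \<Rightarrow> real) \<Rightarrow> bool"
  where "product_norm \<rho> \<longleftrightarrow>
    norm_on (seq_scale (*)) (ell_inf UNIV norm) \<rho> \<and>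
    (\<forall>f\<in>ell_inf UNIV norm. \<forall>g\<in>ell_inf UNIV norm.
       (\<forall>n. norm (f n) \<le> norm (g n)) \<longrightarrow> \<rho> f \<le> \<rho> g) \<and>
    (let B = {f. \<forall>n. norm (f n) \<le> 1} in
       \<forall>A\<subseteq>B. openin (top_of_set B) A \<longleftrightarrow> (\<forall>f\<in>A. \<exists>r>0. \<forall>g\<in>B. \<rho> (f - g) < r \<longrightarrow> g \<in> A))"

definition rho_V :: "((nat \<Rightarrow> 'k::real_normed_field) \<Rightarrow> real) \<Rightarrow> ('w \<Rightarrow> real) \<Rightarrow> (nat \<Rightarrow> 'w) \<Rightarrow> real"
  where "rho_V \<rho> N f = \<rho> (\<lambda>n. of_real (N (f n)))"

text \<open>
  The competing subspaces lie in the ambient space \<open>X\<close>.  \<open>vector_space.dim\<close> is 0 on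
  infinite-dimensional spaces, hence the explicit finite spanning set; the value is \<open>\<infinity>\<close> if there
  is no competing subspace.
\<close>
definition eps_dim ::
    "('k::field \<Rightarrow> 'b::ab_group_add \<Rightarrow> 'b) \<Rightarrow> 'b set \<Rightarrow> ('b \<Rightarrow> real) \<Rightarrow> real \<Rightarrow> 'b set \<Rightarrow> ereal"
  where "eps_dim sc X \<rho> \<epsilon> A =
    (INF W \<in> {W. W \<subseteq> X \<and> module.subspace sc W \<and> (\<exists>B. finite B \<and> W = module.span sc B) \<and>
                 (\<forall>x\<in>A. \<exists>w\<in>W. \<rho> (x - w) < \<epsilon>)}.
       ereal (real (vector_space.dim sc W)))"

definition normalized_dim ::
    "('k::real_normed_field \<Rightarrow> 'w::ab_group_add \<Rightarrow> 'w) \<Rightarrow> 'w set \<Rightarrow> ('w \<Rightarrow> real) \<Rightarrow>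
      ((nat \<Rightarrow> 'k) \<Rightarrow> real) \<Rightarrow> real \<Rightarrow> (nat \<Rightarrow> 'w) set \<Rightarrow> ereal"
  where "normalized_dim sW U N \<rho> \<epsilon> A =
    eps_dim (seq_scale sW) (ell_inf U N) (rho_V \<rho> N) \<epsilon> A / ereal (real (vector_space.dim sW U))"

text \<open>
  A product \<open>g\<^sub>1 \<cdots> g\<^sub>k x\<close> is written \<open>foldr act [g\<^sub>1, \<dots>, g\<^sub>k] x\<close>, and similarly
  \<open>foldr \<sigma> [g\<^sub>1, \<dots>, g\<^sub>k] \<xi>\<close> for the composition of the maps \<open>\<sigma> g\<close>.
\<close>
definition group_words :: "'g set \<Rightarrow> nat \<Rightarrow> 'g list set"
  where "group_words F m = {w. set w \<subseteq> F \<and> 1 \<le> length w \<and> length w \<le> m}"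

text \<open>
  The sections \<open>{(F', m', \<delta>'). F \<subseteq> F' \<and> m \<le> m' \<and> \<delta>' < \<delta>}\<close> of the directed set of triples form a base of
  this filter, so its \<open>Limsup\<close> and \<open>Liminf\<close> are those of nets indexed by the triples.  Eventually
  \<open>\<one> \<in> F\<close> and \<open>m \<ge> 1\<close>.
\<close>
definition triples_at_top :: "('g, 'm) monoid_scheme \<Rightarrow> ('g set \<times> nat \<times> real) filter"
  where "triples_at_top G =
    finite_subsets_at_top (carrier G) \<times>\<^sub>F (sequentially \<times>\<^sub>F at_right 0)"


definition V_span ::
    "('k::field \<Rightarrow> 'v::ab_group_add \<Rightarrow> 'v) \<Rightarrow> ('g \<Rightarrow> 'v \<Rightarrow> 'v) \<Rightarrow> (nat \<Rightarrow> 'v) \<Rightarrow> 'g set \<Rightarrow> nat \<Rightarrow> 'v set"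
  where "V_span sV act S F m = module.span sV {foldr act w (S j) | w j. w \<in> group_words F m \<and> j < m}"

text \<open>Only the values on \<open>V_span\<close> of the members \<open>T\<close> matter.\<close>
definition Hom_Gamma ::
    "('k::field \<Rightarrow> 'v::real_normed_vector \<Rightarrow> 'v) \<Rightarrow> ('k \<Rightarrow> 'w::ab_group_add \<Rightarrow> 'w) \<Rightarrow> ('g \<Rightarrow> 'v \<Rightarrow> 'v) \<Rightarrow>
      'w set \<Rightarrow> ('w \<Rightarrow> real) \<Rightarrow> ('g \<Rightarrow> 'w \<Rightarrow> 'w) \<Rightarrow> (nat \<Rightarrow> 'v) \<Rightarrow> 'g set \<Rightarrow> nat \<Rightarrow> real \<Rightarrow> ('v \<Rightarrow> 'w) set"
  where "Hom_Gamma sV sW act U N \<sigma> S F m \<delta> =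
    {T. linear_on sV sW (V_span sV act S F m) U T \<and>
        (\<forall>v\<in>V_span sV act S F m. N (T v) \<le> norm v) \<and>
        (\<forall>w\<in>group_words F m. \<forall>j<m. N (T (foldr act w (S j)) - foldr \<sigma> w (T (S j))) < \<delta>)}"

definition alpha :: "(nat \<Rightarrow> 'v) \<Rightarrow> nat \<Rightarrow> ('v \<Rightarrow> 'w::zero) \<Rightarrow> nat \<Rightarrow> 'w"
  where "alpha S m T = (\<lambda>n. if n < m then T (S n) else 0)"

definition dim_Sigma ::
    "('g, 'm) monoid_scheme \<Rightarrow> ('k::real_normed_field \<Rightarrow> 'v::real_normed_vector \<Rightarrow> 'v) \<Rightarrow>
      ('k \<Rightarrow> 'w::ab_group_add \<Rightarrow> 'w) \<Rightarrow> ('g \<Rightarrow> 'v \<Rightarrow> 'v) \<Rightarrow>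
      (nat \<Rightarrow> 'w set) \<Rightarrow> (nat \<Rightarrow> 'w \<Rightarrow> real) \<Rightarrow> (nat \<Rightarrow> 'g \<Rightarrow> 'w \<Rightarrow> 'w) \<Rightarrow>
      (nat \<Rightarrow> 'v) \<Rightarrow> ((nat \<Rightarrow> 'k) \<Rightarrow> real) \<Rightarrow> ereal"
  where "dim_Sigma G sV sW act U N \<sigma> S \<rho> =
    (SUP \<epsilon>\<in>{0<..}. Limsup (triples_at_top G) (\<lambda>(F, m, \<delta>).
       limsup (\<lambda>i. normalized_dim sW (U i) (N i) \<rho> \<epsilon>
         (alpha S m ` Hom_Gamma sV sW act (U i) (N i) (\<sigma> i) S F m \<delta>))))"


text \<open>
  A tuple of \<open>m\<close> vectors is a sequence vanishing from index \<open>m\<close> on.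
\<close>
definition Vect_Gamma ::
    "('k::real_normed_field \<Rightarrow> 'v::real_normed_vector \<Rightarrow> 'v) \<Rightarrow> ('k \<Rightarrow> 'w::ab_group_add \<Rightarrow> 'w) \<Rightarrow>
      ('g \<Rightarrow> 'v \<Rightarrow> 'v) \<Rightarrow> 'w set \<Rightarrow> ('w \<Rightarrow> real) \<Rightarrow> ('g \<Rightarrow> 'w \<Rightarrow> 'w) \<Rightarrow> (nat \<Rightarrow> 'v) \<Rightarrow>
      'g set \<Rightarrow> nat \<Rightarrow> real \<Rightarrow> (nat \<Rightarrow> 'w) set"
  where "Vect_Gamma sV sW act U N \<sigma> S F m \<delta> =
    {\<xi>. (\<forall>j<m. \<xi> j \<in> U) \<and> (\<forall>j\<ge>m. \<xi> j = 0) \<and>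
        (\<forall>c :: 'g list \<Rightarrow> nat \<Rightarrow> 'k.
           (\<Sum>w\<in>group_words F m. \<Sum>j<m. norm (c w j)) \<le> 1 \<longrightarrow>
           N (\<Sum>w\<in>group_words F m. \<Sum>j<m. sW (c w j) (foldr \<sigma> w (\<xi> j)))
             \<le> \<delta> + norm (\<Sum>w\<in>group_words F m. \<Sum>j<m. sV (c w j) (foldr act w (S j))))}"

text \<open>
  The infimum over \<open>(F, m, \<delta>)\<close> in the definition of \<open>vdim\<close> is read along the directed set of triples,
  that is, as \<open>Liminf\<close>.  The number of vectors in a tuple is \<open>m\<close>, so the quantity is not monotone in
  \<open>m\<close>, and an infimum over all triples is determined by short tuples: it is 0 whenever \<open>S 0 = 0\<close>, as
  \<open>m = 1\<close> shows.
\<close>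
definition vdim_Sigma ::
    "('g, 'm) monoid_scheme \<Rightarrow> ('k::real_normed_field \<Rightarrow> 'v::real_normed_vector \<Rightarrow> 'v) \<Rightarrow>
      ('k \<Rightarrow> 'w::ab_group_add \<Rightarrow> 'w) \<Rightarrow> ('g \<Rightarrow> 'v \<Rightarrow> 'v) \<Rightarrow>
      (nat \<Rightarrow> 'w set) \<Rightarrow> (nat \<Rightarrow> 'w \<Rightarrow> real) \<Rightarrow> (nat \<Rightarrow> 'g \<Rightarrow> 'w \<Rightarrow> 'w) \<Rightarrow>
      (nat \<Rightarrow> 'v) \<Rightarrow> ((nat \<Rightarrow> 'k) \<Rightarrow> real) \<Rightarrow> ereal"
  where "vdim_Sigma G sV sW act U N \<sigma> S \<rho> =
    (SUP \<epsilon>\<in>{0<..}. Liminf (triples_at_top G) (\<lambda>(F, m, \<delta>).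
       limsup (\<lambda>i. normalized_dim sW (U i) (N i) \<rho> \<epsilon>
         (Vect_Gamma sV sW act (U i) (N i) (\<sigma> i) S F m \<delta>))))"

end

theory Submission
  imports Defs
begin

text \<open>
  Two inequalities suffice, each for all generating sequences and product norms:
  \<open>dim(S', \<rho>') \<le> vdim(S, \<rho>)\<close> and \<open>vdim(S, \<rho>) \<le> dim(S, \<rho>)\<close>.  Chaining them gives
  \<open>vdim(S) \<le> dim(S) \<le> vdim(S') \<le> dim(S') \<le> vdim(S)\<close>, so the independence of \<open>S\<close> and \<open>\<rho>\<close> is a
  by-product.

  For the first, approximate each \<open>S j\<close> by a combination \<open>\<Sum>k. c k \<cdot> g k (S' k)\<close>.  A map
  \<open>T\<close> in \<open>Hom(S')\<close> then yields the tuple \<open>\<xi> j = \<Sum>k. c k \<cdot> \<sigma> (g k) (T (S' k))\<close>, which lies in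
  \<open>Vect(S)\<close>.  Approximating \<open>S' n\<close> in turn by combinations of translates of the \<open>S j\<close>
  gives a linear map on sequences that recovers \<open>T (S' n)\<close> from \<open>\<xi>\<close> for the finitely many \<open>n\<close> which
  \<open>\<rho>'\<close> sees, and a linear map does not increase the dimension of an approximating subspace.
  The coefficients of this map depend on \<open>\<epsilon>\<close> only, so a radius \<open>\<epsilon>'\<close> can be fixed before the
  triple \<open>(F, m, \<delta>)\<close> for \<open>S\<close>.

  For the second, fix \<open>F\<close> and \<open>m\<close>.  The space \<open>V_span\<close> has a basis of vectors \<open>g\<^sub>1\<cdots>g\<^sub>k (S j)\<close>, and
  coordinates are bounded on it.  Hence a tuple \<open>\<xi>\<close> in \<open>Vect\<close> with sufficiently small \<open>\<delta>'\<close> defines,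
  by \<open>g\<^sub>1\<cdots>g\<^sub>k (S j) \<mapsto> \<sigma> g\<^sub>1\<cdots>\<sigma> g\<^sub>k (\<xi> j)\<close> on the basis, a linear map of norm at most \<open>1 + O(\<delta>')\<close> that is
  almost equivariant; rescaling it gives an element of \<open>Hom\<close> close to \<open>\<xi>\<close>.
\<close>

subsection \<open>Approximation by linear images\<close>

lemma vector_space_seq_scale:
  assumes "vector_space s"
  shows "vector_space (seq_scale s)"
proof -
  interpret vector_space s by fact
  show ?thesis
    by unfold_locales
      (auto simp: seq_scale_def fun_eq_iff scale_right_distrib scale_left_distrib)
qed

text \<open>A subspace \<open>W\<close> that competes for \<open>B\<close> is pushed forward by
  \<open>L\<close> to one that competes for \<open>A\<close>, and its dimension does not grow. In
  \<open>approx\<close> a single \<open>y\<close> serves all \<open>w\<close> in \<open>X\<close>,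
  so it can be chosen before \<open>W\<close> is known.\<close>

lemma eps_dim_le_linear:
  assumes "vector_space sc" and X: "module.subspace sc X" and L: "linear_on sc sc X X L"
    and approx: "\<And>x. x \<in> A \<Longrightarrow> \<exists>y\<in>B. \<forall>w\<in>X. \<rho> (y - w) < \<epsilon>' \<longrightarrow> \<rho>' (x - L w) < \<epsilon>"
  shows "eps_dim sc X \<rho>' \<epsilon> A \<le> eps_dim sc X \<rho> \<epsilon>' B"
proof -
  interpret vector_space sc by fact
  show ?thesis
    unfolding eps_dim_def
  proof (rule INF_mono)
    fix W assume "W \<in> {W. W \<subseteq> X \<and> subspace W \<and> (\<exists>B. finite B \<and> W = span B) \<and>
                 (\<forall>x\<in>B. \<exists>w\<in>W. \<rho> (x - w) < \<epsilon>')}"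
    then obtain E where W: "W \<subseteq> X" "\<forall>x\<in>B. \<exists>w\<in>W. \<rho> (x - w) < \<epsilon>'"
      and E: "finite E" "W = span E"
      by blast
    obtain D where D: "D \<subseteq> W" "independent D" "W \<subseteq> span D" "card D = dim W"
      using basis_exists by blast
    have "finite D"
      using independent_span_bound[OF E(1) D(2)] D(1) E(2) by simp
    \<comment> \<open>Taking the span of the images of a basis, rather than the image of
      \<open>W\<close>, makes \<open>card D\<close> a bound for the dimension at once;
      \<open>L\<close> is linear on \<open>X\<close> only.\<close>
    let ?W = "span (L ` D)"
    have "subspace {w\<in>X. L w \<in> ?W}"
    proof (rule subspaceI)
      \<comment> \<open>\<open>linear_on\<close> does not list preservation of 0; it follows from
        homogeneity at the scalar 0.\<close>
      have "L 0 = L (sc 0 0)" by simp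
      also have "\<dots> = sc 0 (L 0)"
        using L subspace_0[OF X] unfolding linear_on_def by blast
      finally have "L 0 = 0" by simp
      then show "0 \<in> {w\<in>X. L w \<in> ?W}"
        using subspace_0[OF X] span_zero by simp
    qed (use L in \<open>auto simp: linear_on_def subspace_add[OF X] subspace_scale[OF X]
          intro: span_add span_scale\<close>)
    then have "span D \<subseteq> {w\<in>X. L w \<in> ?W}"
      by (rule span_minimal[rotated]) (use D(1) W(1) in \<open>auto intro: span_base\<close>)
    then have LW: "L w \<in> ?W" if "w \<in> W" for w
      using that D(3) by blast
    have "?W \<subseteq> X"
      by (rule span_minimal[OF _ X]) (use D(1) W(1) L in \<open>auto simp: linear_on_def\<close>)
    moreover have "\<exists>w\<in>?W. \<rho>' (x - w) < \<epsilon>" if "x \<in> A" for x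
      using approx[OF that] W LW by (meson subsetD)
    moreover have "dim ?W \<le> dim W"
      using dim_le_card'[of "L ` D"] card_image_le[OF \<open>finite D\<close>, of L] D(4) \<open>finite D\<close>
      by (simp add: dim_span)
    ultimately show "\<exists>W'\<in>{W. W \<subseteq> X \<and> subspace W \<and> (\<exists>B. finite B \<and> W = span B) \<and>
                 (\<forall>x\<in>A. \<exists>w\<in>W. \<rho>' (x - w) < \<epsilon>)}. ereal (real (dim W')) \<le> ereal (real (dim W))"
      using \<open>finite D\<close> by (intro bexI[of _ ?W]) auto
  qed
qed

section \<open>Norms on a subspace and bounded sequences in it\<close>

locale normed_subspace = vector_space s
  for s :: "'k::real_normed_field \<Rightarrow> 'b::ab_group_add \<Rightarrow> 'b" +
  fixes U :: "'b set" and N :: "'b \<Rightarrow> real"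
  assumes subspace_U: "subspace U"
    and norm_N: "norm_on s U N"
begin

lemma N_nonneg: "x \<in> U \<Longrightarrow> 0 \<le> N x"
  and N_add: "x \<in> U \<Longrightarrow> y \<in> U \<Longrightarrow> N (x + y) \<le> N x + N y"
  and N_scale: "x \<in> U \<Longrightarrow> N (s c x) = norm c * N x"
  using norm_N by (auto simp: norm_on_def)

lemma N_0 [simp]: "N 0 = 0"
  using norm_N subspace_0[OF subspace_U] by (auto simp: norm_on_def)

lemma N_minus: "x \<in> U \<Longrightarrow> N (- x) = N x"
  using N_scale[of x "-1"] by simp

lemma N_minus_commute: "x \<in> U \<Longrightarrow> y \<in> U \<Longrightarrow> N (x - y) = N (y - x)"
  using N_minus[of "x - y"] subspace_diff[OF subspace_U, of x y] by simp

lemma N_diff_triangle: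
  "x \<in> U \<Longrightarrow> y \<in> U \<Longrightarrow> z \<in> U \<Longrightarrow> N (x - z) \<le> N (x - y) + N (y - z)"
  using N_add[of "x - y" "y - z"] by (simp add: subspace_diff[OF subspace_U])

lemma N_sum: "(\<And>k. k \<in> K \<Longrightarrow> f k \<in> U) \<Longrightarrow> N (sum f K) \<le> (\<Sum>k\<in>K. N (f k))"
proof (induction K rule: infinite_finite_induct)
  case (insert k K)
  then show ?case
    using N_add[of "f k" "sum f K"] subspace_sum[OF subspace_U, of K f] by auto
qed simp_all

lemma linear_on_comb:
  assumes "vector_space s1" "module.subspace s1 A" "linear_on s1 s A U T"
    and "\<And>k. k \<in> K \<Longrightarrow> a k \<in> A"
  shows "T (\<Sum>k\<in>K. s1 (c k) (a k)) = (\<Sum>k\<in>K. s (c k) (T (a k)))"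
proof -
  interpret V1: vector_space s1 by fact
  note A = assms(2)
  have "T (s1 0 0) = s 0 (T 0)"
    using assms(3) V1.subspace_0[OF A] unfolding linear_on_def by blast
  then have T0: "T 0 = 0" by simp
  show ?thesis
    using assms(4)
  proof (induction K rule: infinite_finite_induct)
    case (insert k K)
    have "(\<Sum>k\<in>K. s1 (c k) (a k)) \<in> A"
      using insert.prems by (intro V1.subspace_sum[OF A] V1.subspace_scale[OF A]) auto
    moreover have "s1 (c k) (a k) \<in> A"
      using insert.prems by (intro V1.subspace_scale[OF A]) auto
    ultimately show ?case
      using insert assms(3) by (simp add: linear_on_def)
  qed (simp_all add: T0)
qed

text \<open>The difference is the combination of the errors \<open>T (a k) - b k\<close>. With
  \<open>T\<close> the identity (\<open>linear_on_id\<close>) this also compares two combinations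
  inside one space.\<close>

lemma linear_comb_approx:
  assumes "vector_space s1" "module.subspace s1 A" "linear_on s1 s A U T"
    and a: "\<And>k. k \<in> K \<Longrightarrow> a k \<in> A" and b: "\<And>k. k \<in> K \<Longrightarrow> b k \<in> U"
    and le: "\<And>k. k \<in> K \<Longrightarrow> N (T (a k) - b k) \<le> \<kappa>"
  shows "N (T (\<Sum>k\<in>K. s1 (c k) (a k)) - (\<Sum>k\<in>K. s (c k) (b k))) \<le> (\<Sum>k\<in>K. norm (c k)) * \<kappa>"
proof -
  have TU: "T (a k) - b k \<in> U" if "k \<in> K" for k
    using assms(3) a[OF that] b[OF that] subspace_diff[OF subspace_U] by (auto simp: linear_on_def)
  have "T (\<Sum>k\<in>K. s1 (c k) (a k)) - (\<Sum>k\<in>K. s (c k) (b k)) = (\<Sum>k\<in>K. s (c k) (T (a k) - b k))"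
    by (simp add: linear_on_comb[OF assms(1-3) a] sum_subtractf scale_right_diff_distrib)
  also have "N \<dots> \<le> (\<Sum>k\<in>K. N (s (c k) (T (a k) - b k)))"
    by (intro N_sum subspace_scale[OF subspace_U] TU)
  also have "\<dots> \<le> (\<Sum>k\<in>K. norm (c k) * \<kappa>)"
    by (intro sum_mono) (auto simp: N_scale TU le intro: mult_left_mono)
  finally show ?thesis
    by (simp add: sum_distrib_right)
qed

lemma linear_on_id: "linear_on s s U U (\<lambda>x. x)"
  by (simp add: linear_on_def)

lemma subspace_ell_inf: "module.subspace (seq_scale s) (ell_inf U N)"
proof -
  interpret S: vector_space "seq_scale s"
    by (rule vector_space_seq_scale) unfold_locales
  show ?thesis
  proof (rule S.subspaceI)
    show "0 \<in> ell_inf U N"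
      using subspace_0[OF subspace_U] by (auto simp: ell_inf_def)
  next
    fix f g assume "f \<in> ell_inf U N" "g \<in> ell_inf U N"
    then obtain C D where "\<And>n. f n \<in> U" "\<And>n. g n \<in> U" "\<And>n. N (f n) \<le> C" "\<And>n. N (g n) \<le> D"
      by (auto simp: ell_inf_def)
    then have "N (f n + g n) \<le> C + D" for n
      using N_add[of "f n" "g n"] by (meson add_mono order_trans)
    then show "f + g \<in> ell_inf U N"
      using \<open>\<And>n. f n \<in> U\<close> \<open>\<And>n. g n \<in> U\<close> subspace_add[OF subspace_U] by (auto simp: ell_inf_def)
  next
    fix c f assume "f \<in> ell_inf U N"
    then obtain C where f: "\<And>n. f n \<in> U" "\<And>n. N (f n) \<le> C"
      by (auto simp: ell_inf_def)
    then have "N (s c (f n)) \<le> norm c * C" for n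
      by (simp add: N_scale mult_left_mono)
    then show "seq_scale s c f \<in> ell_inf U N"
      using f(1) subspace_scale[OF subspace_U] by (auto simp: ell_inf_def seq_scale_def)
  qed
qed

lemma ell_inf_finite_support:
  assumes "\<And>n. f n \<in> U" "\<And>n. M \<le> n \<Longrightarrow> f n = 0"
  shows "f \<in> ell_inf U N"
proof -
  have "N (f n) \<le> (\<Sum>n<M. N (f n))" for n
  proof (cases "n < M")
    case True
    then show ?thesis
      using N_nonneg[OF assms(1)] by (intro member_le_sum) auto
  next
    case False
    then have "N (f n) = 0"
      using assms(2) by simp
    also have "0 \<le> (\<Sum>n<M. N (f n))"
      using N_nonneg[OF assms(1)] by (rule sum_nonneg)
    finally show ?thesis .
  qed
  then show ?thesis
    using assms(1) by (auto simp: ell_inf_def)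
qed

lemma ell_inf_of_real:
  "f \<in> ell_inf U N \<Longrightarrow> (\<lambda>n. of_real (N (f n)) :: 'k) \<in> ell_inf UNIV norm"
  by (auto simp: ell_inf_def abs_of_nonneg N_nonneg)

end

subsection \<open>Product norms\<close>

lemma product_norm_mono:
  assumes "product_norm \<rho>" "f \<in> ell_inf UNIV norm" "g \<in> ell_inf UNIV norm"
    and "\<And>n. norm (f n) \<le> norm (g n)"
  shows "\<rho> f \<le> \<rho> g"
  using assms by (simp add: product_norm_def)

lemma product_norm_nonneg: "product_norm \<rho> \<Longrightarrow> f \<in> ell_inf UNIV norm \<Longrightarrow> 0 \<le> \<rho> f"
  and product_norm_eq_0_iff: "product_norm \<rho> \<Longrightarrow> f \<in> ell_inf UNIV norm \<Longrightarrow> \<rho> f = 0 \<longleftrightarrow> f = 0"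
  and product_norm_add: "product_norm \<rho> \<Longrightarrow> f \<in> ell_inf UNIV norm \<Longrightarrow> g \<in> ell_inf UNIV norm
    \<Longrightarrow> \<rho> (f + g) \<le> \<rho> f + \<rho> g"
  and product_norm_scale: "product_norm \<rho> \<Longrightarrow> f \<in> ell_inf UNIV norm
    \<Longrightarrow> \<rho> (seq_scale (*) c f) = norm c * \<rho> f"
  by (simp_all add: product_norm_def norm_on_def)

lemma product_norm_coord_pos:
  fixes \<rho> :: "(nat \<Rightarrow> 'k::real_normed_field) \<Rightarrow> real"
  assumes \<rho>: "product_norm \<rho>"
  shows "0 < \<rho> (\<lambda>n. if n = j then 1 else 0)"
proof -
  let ?e = "\<lambda>n. if n = j then 1 else 0 :: 'k"
  have e: "?e \<in> ell_inf UNIV norm"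
    by (auto simp: ell_inf_def intro!: exI[of _ 1])
  have "?e \<noteq> 0"
  proof
    assume "?e = 0"
    then have "?e j = 0 j"
      by (rule fun_cong)
    then show False
      by simp
  qed
  then show ?thesis
    using product_norm_nonneg[OF \<rho> e] product_norm_eq_0_iff[OF \<rho> e] by linarith
qed

text \<open>By the triangle inequality, radius \<open>r - \<rho> f\<close> around \<open>f\<close>
  stays inside the ball. The last conjunct of \<open>product_norm\<close> then converts openness for
  the metric of \<rho> into openness for the product topology.\<close>

lemma product_norm_ball_open:
  assumes \<rho>: "product_norm \<rho>"
  defines "B \<equiv> {f. \<forall>n. norm (f n) \<le> 1}"
  shows "openin (top_of_set B) {f\<in>B. \<rho> f < r}"
proof -
  have B: "B \<subseteq> ell_inf UNIV norm"
    by (auto simp: B_def ell_inf_def)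
  have "\<exists>t>0. \<forall>g\<in>B. \<rho> (f - g) < t \<longrightarrow> g \<in> {f\<in>B. \<rho> f < r}" if f: "f \<in> B" "\<rho> f < r" for f
  proof (intro exI[of _ "r - \<rho> f"] conjI ballI impI)
    fix g assume g: "g \<in> B" "\<rho> (f - g) < r - \<rho> f"
    have "norm (f n - g n) \<le> 2" for n
    proof -
      have "norm (f n) \<le> 1" "norm (g n) \<le> 1"
        using f(1) g(1) by (simp_all add: B_def)
      then show ?thesis
        using norm_triangle_ineq4[of "f n" "g n"] by linarith
    qed
    then have fg: "f - g \<in> ell_inf UNIV norm"
      by (auto simp: ell_inf_def)
    have gf: "seq_scale (*) (-1) (f - g) = g - f"
      by (auto simp: seq_scale_def fun_eq_iff)
    have "\<rho> (g - f) = \<rho> (f - g)"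
      using product_norm_scale[OF \<rho> fg, of "-1"] gf by simp
    moreover have "norm ((g - f) n) \<le> norm ((f - g) n)" for n
      by (simp add: norm_minus_commute)
    then have "g - f \<in> ell_inf UNIV norm"
      using fg by (fastforce simp: ell_inf_def norm_minus_commute)
    then have "\<rho> (f + (g - f)) \<le> \<rho> f + \<rho> (g - f)"
      using f(1) B by (intro product_norm_add[OF \<rho>]) auto
    ultimately show "g \<in> {f\<in>B. \<rho> f < r}"
      using g by simp
  qed (use f in simp)
  then have nbhd: "\<forall>f\<in>{f\<in>B. \<rho> f < r}. \<exists>t>0. \<forall>g\<in>B. \<rho> (f - g) < t \<longrightarrow> g \<in> {f\<in>B. \<rho> f < r}"
    by blast
  have top: "\<forall>A\<subseteq>B. openin (top_of_set B) A \<longleftrightarrow>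
      (\<forall>f\<in>A. \<exists>t>0. \<forall>g\<in>B. \<rho> (f - g) < t \<longrightarrow> g \<in> A)"
    using \<rho> unfolding product_norm_def Let_def B_def by (elim conjE)
  show ?thesis
    by (rule iffD2[OF mp[OF spec[OF top] Collect_restrict] nbhd])
qed

text \<open>A \<rho>-ball around 0 contains a basic neighbourhood of the product topology, and this
  restricts finitely many coordinates only. So on sequences bounded by \<open>R\<close>, smallness
  of \<rho> is decided by an initial segment.\<close>

lemma product_norm_small:
  fixes \<rho> :: "(nat \<Rightarrow> 'k::real_normed_field) \<Rightarrow> real"
  assumes \<rho>: "product_norm \<rho>" and "\<epsilon> > 0" "R > 0"
  obtains \<eta> M where "\<eta> > 0"
    "\<forall>f. (\<forall>n. norm (f n) \<le> R) \<longrightarrow> (\<forall>n<M. norm (f n) \<le> \<eta>) \<longrightarrow> \<rho> f < \<epsilon>"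
proof -
  let ?B = "{f :: nat \<Rightarrow> 'k. \<forall>n. norm (f n) \<le> 1}"
  let ?A = "{f\<in>?B. \<rho> f < \<epsilon> / R}"
  obtain O' where O': "open O'" "?A = ?B \<inter> O'"
    using product_norm_ball_open[OF \<rho>, of "\<epsilon> / R"] unfolding openin_open by blast
  have "(0::nat \<Rightarrow> 'k) \<in> ell_inf UNIV norm"
    by (auto simp: ell_inf_def)
  then have "\<rho> 0 = 0"
    using product_norm_eq_0_iff[OF \<rho>] by simp
  then have "0 \<in> ?A"
    using assms by simp
  then have "0 \<in> O'"
    using O'(2) by blast
  moreover have "openin (product_topology (\<lambda>i::nat. euclidean) UNIV) O'"
    using O'(1) by (simp add: open_fun_def)
  ultimately obtain X :: "nat \<Rightarrow> 'k set" where X: "0 \<in> (\<Pi>\<^sub>E i\<in>UNIV. X i)" "\<And>i. open (X i)"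
    "finite {i. X i \<noteq> UNIV}" "(\<Pi>\<^sub>E i\<in>UNIV. X i) \<subseteq> O'"
    using product_topology_open_contains_basis[of "\<lambda>i::nat. euclidean :: 'k topology" UNIV O' 0]
    by auto
  \<comment> \<open>Since only finitely many factors are restricted, one radius \<open>e\<close>
    serves all of them, and some \<open>M\<close> exceeds all their indices.\<close>
  have "\<forall>i\<in>{i. X i \<noteq> UNIV}. \<forall>\<^sub>F e in at_right 0. cball 0 e \<subseteq> X i"
  proof
    fix i
    have "0 \<in> X i"
      using X(1) by (auto simp: PiE_iff)
    then obtain e where "e > 0" "cball 0 e \<subseteq> X i"
      using X(2)[of i] unfolding open_contains_cball by blast
    then show "\<forall>\<^sub>F e in at_right 0. cball 0 e \<subseteq> X i"
      unfolding eventually_at_right_field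
      by (intro exI[of _ e]) (auto intro!: order_trans[OF subset_cball])
  qed
  then have "\<forall>\<^sub>F e in at_right (0::real). \<forall>i\<in>{i. X i \<noteq> UNIV}. cball 0 e \<subseteq> X i"
    using X(3) by (rule eventually_ball_finite[rotated])
  then have "\<forall>\<^sub>F e in at_right (0::real). e > 0 \<and> (\<forall>i\<in>{i. X i \<noteq> UNIV}. cball 0 e \<subseteq> X i)"
    using eventually_at_right_less by eventually_elim auto
  then obtain e where e: "e > 0" "\<And>i. X i \<noteq> UNIV \<Longrightarrow> cball 0 e \<subseteq> X i"
    using eventually_happens'[OF trivial_limit_at_right_real[of 0]] by blast
  obtain M where M: "\<And>i. X i \<noteq> UNIV \<Longrightarrow> i < M"
    using X(3) finite_nat_set_iff_bounded by auto
  show ?thesis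
  proof (rule that[of "R * e" M], safe)
    fix f :: "nat \<Rightarrow> 'k"
    assume "\<forall>n. norm (f n) \<le> R" "\<forall>n<M. norm (f n) \<le> R * e"
    then have f: "\<And>n. norm (f n) \<le> R" "\<And>n. n < M \<Longrightarrow> norm (f n) \<le> R * e"
      by auto
    \<comment> \<open>Dividing by \<open>R\<close> brings \<open>f\<close> into the unit ball, where
      the topology of \<rho> is prescribed; this is the origin of the radius
      \<open>\<epsilon> / R\<close> in \<open>?A\<close>.\<close>
    let ?f = "seq_scale (*) (of_real (1 / R)) f"
    have nf: "norm (?f n) = norm (f n) / R" for n
      using \<open>R > 0\<close> by (simp add: seq_scale_def norm_mult norm_divide)
    have "?f i \<in> X i" for i
    proof (cases "X i = UNIV")
      case False
      then have "norm (?f i) \<le> e"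
        using f(2)[OF M[OF False]] \<open>R > 0\<close> unfolding nf by (simp add: divide_le_eq mult.commute)
      then show ?thesis
        using e(2)[OF False] by auto
    qed simp
    then have "?f \<in> O'"
      using X(4) by (auto simp: PiE_iff)
    moreover have "?f \<in> ?B"
      using f(1) \<open>R > 0\<close> unfolding mem_Collect_eq nf by simp
    ultimately have "\<rho> ?f < \<epsilon> / R"
      using O'(2) by blast
    moreover have "f \<in> ell_inf UNIV norm"
      using f(1) by (auto simp: ell_inf_def)
    ultimately show "\<rho> f < \<epsilon>"
      using product_norm_scale[OF \<rho>, of f "of_real (1 / R)"] \<open>R > 0\<close>
      by (simp add: field_simps norm_divide)
  qed (use e \<open>R > 0\<close> in simp)
qed

section \<open>Vector-valued sequences measured by a product norm\<close>

context normed_subspace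
begin

lemma rho_V_add:
  fixes \<rho> :: "(nat \<Rightarrow> 'k) \<Rightarrow> real"
  assumes \<rho>: "product_norm \<rho>" and fg: "f \<in> ell_inf U N" "g \<in> ell_inf U N"
  shows "rho_V \<rho> N (f + g) \<le> rho_V \<rho> N f + rho_V \<rho> N g"
proof -
  interpret S: vector_space "seq_scale s"
    by (rule vector_space_seq_scale) unfold_locales
  have fgU: "f n \<in> U" "g n \<in> U" for n
    using fg by (auto simp: ell_inf_def)
  let ?c = "\<lambda>f n. of_real (N (f n)) :: 'k"
  have fg': "f + g \<in> ell_inf U N"
    by (rule S.subspace_add[OF subspace_ell_inf fg])
  have bd: "?c f \<in> ell_inf UNIV norm" "?c g \<in> ell_inf UNIV norm" "?c (f + g) \<in> ell_inf UNIV norm"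
    using fg fg' ell_inf_of_real by blast+
  have le: "norm (?c (f + g) n) \<le> norm ((?c f + ?c g) n)" for n
    using N_add[OF fgU(1)[of n] fgU(2)[of n]] N_nonneg[OF fgU(1)] N_nonneg[OF fgU(2)]
      subspace_add[OF subspace_U fgU(1)[of n] fgU(2)[of n]]
    by (auto simp: N_nonneg simp flip: of_real_add)
  obtain C D where "\<And>n. N (f n) \<le> C" "\<And>n. N (g n) \<le> D"
    using fg by (auto simp: ell_inf_def)
  then have "norm ((?c f + ?c g) n) \<le> C + D" for n
    using N_nonneg[OF fgU(1)[of n]] N_nonneg[OF fgU(2)[of n]]
    by (auto simp: add_mono simp flip: of_real_add)
  then have "?c f + ?c g \<in> ell_inf UNIV norm"
    by (auto simp: ell_inf_def)
  then have "\<rho> (?c (f + g)) \<le> \<rho> (?c f + ?c g)"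
    using le by (intro product_norm_mono[OF \<rho> bd(3)])
  also have "\<dots> \<le> \<rho> (?c f) + \<rho> (?c g)"
    by (rule product_norm_add[OF \<rho> bd(1,2)])
  finally show ?thesis
    by (simp add: rho_V_def)
qed

text \<open>Monotonicity compares \<open>f\<close> with its \<open>j\<close>-th entry alone. The
  weight on the left is positive by \<open>product_norm_coord_pos\<close>, so closeness in
  \<open>rho_V\<close> gives closeness of every single coordinate.\<close>

lemma rho_V_coord:
  fixes \<rho> :: "(nat \<Rightarrow> 'k) \<Rightarrow> real"
  assumes \<rho>: "product_norm \<rho>" and f: "f \<in> ell_inf U N"
  shows "N (f j) * \<rho> (\<lambda>n. if n = j then 1 else 0) \<le> rho_V \<rho> N f"
proof -
  have fU: "f n \<in> U" for n
    using f by (auto simp: ell_inf_def)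
  let ?e = "\<lambda>n. if n = j then 1 else 0 :: 'k"
  have e: "?e \<in> ell_inf UNIV norm"
    by (auto simp: ell_inf_def intro!: exI[of _ 1])
  have "norm (seq_scale (*) (of_real (N (f j))) ?e n) \<le> N (f j)" for n
    using N_nonneg[OF fU] by (auto simp: seq_scale_def)
  then have "seq_scale (*) (of_real (N (f j))) ?e \<in> ell_inf UNIV norm"
    by (auto simp: ell_inf_def)
  then have "\<rho> (seq_scale (*) (of_real (N (f j))) ?e) \<le> rho_V \<rho> N f"
    unfolding rho_V_def
    by (intro product_norm_mono[OF \<rho>] ell_inf_of_real f) (auto simp: seq_scale_def)
  then show ?thesis
    using product_norm_scale[OF \<rho> e, of "of_real (N (f j))"] N_nonneg[OF fU] by simp
qed

text \<open>Monotonicity against the constant sequence \<kappa>.\<close>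

lemma rho_V_le_const:
  fixes \<rho> :: "(nat \<Rightarrow> 'k) \<Rightarrow> real"
  assumes \<rho>: "product_norm \<rho>" and f: "f \<in> ell_inf U N" and le: "\<And>n. N (f n) \<le> \<kappa>"
  shows "rho_V \<rho> N f \<le> \<kappa> * \<rho> 1"
proof -
  have fU: "f n \<in> U" for n
    using f by (auto simp: ell_inf_def)
  have \<kappa>: "\<kappa> \<ge> 0"
    using le[of 0] N_nonneg[OF fU[of 0]] by simp
  have "seq_scale (*) (of_real \<kappa>) (1 :: nat \<Rightarrow> 'k) \<in> ell_inf UNIV norm"
    and one: "(1 :: nat \<Rightarrow> 'k) \<in> ell_inf UNIV norm"
    by (auto simp: ell_inf_def seq_scale_def)
  then have "rho_V \<rho> N f \<le> \<rho> (seq_scale (*) (of_real \<kappa>) 1)"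
    unfolding rho_V_def
    by (intro product_norm_mono[OF \<rho> ell_inf_of_real[OF f]])
      (use \<kappa> le N_nonneg[OF fU] in \<open>auto simp: seq_scale_def\<close>)
  then show ?thesis
    using product_norm_scale[OF \<rho> one, of "of_real \<kappa>"] \<kappa> by simp
qed

end

subsection \<open>Finite-dimensional subspaces of Banach spaces\<close>

text \<open>Different indices \<open>k\<close> may name the same pair \<open>p k\<close> of a word
  and an index, while \<open>Vect_Gamma\<close> has one coefficient per pair. Coefficients are
  therefore collected over the fibres of \<open>p\<close>.\<close>

lemma (in vector_space) sum_group_scale:
  assumes "finite K" "finite I" "p ` K \<subseteq> I"
  shows "(\<Sum>q\<in>I. scale (\<Sum>k\<in>{k\<in>K. p k = q}. c k) (X q)) = (\<Sum>k\<in>K. scale (c k) (X (p k)))"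
proof -
  have "(\<Sum>q\<in>I. scale (\<Sum>k\<in>{k\<in>K. p k = q}. c k) (X q))
      = (\<Sum>q\<in>I. \<Sum>k\<in>{k\<in>K. p k = q}. scale (c k) (X (p k)))"
    by (intro sum.cong) (auto simp: scale_sum_left)
  also have "\<dots> = (\<Sum>k\<in>K. scale (c k) (X (p k)))"
    by (rule sum.group[OF assms])
  finally show ?thesis .
qed

text \<open>One index is selected for each vector that occurs, so that the coefficients belong to
  indices and can be reused with another family over the same index set.\<close>

lemma (in vector_space) span_image_explicit:
  assumes "v \<in> span (f ` I)"
  obtains K c where "finite K" "K \<subseteq> I" "v = (\<Sum>k\<in>K. scale (c k) (f k))"
proof -
  obtain t r where t: "finite t" "t \<subseteq> f ` I" "v = (\<Sum>a\<in>t. scale (r a) a)"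
    using assms unfolding span_explicit by blast
  obtain K where K: "K \<subseteq> I" "inj_on f K" "t = f ` K"
    using t(2) unfolding subset_image_inj by blast
  show ?thesis
  proof
    show "finite K"
      using t(1) K by (simp add: finite_image_iff)
    show "v = (\<Sum>k\<in>K. scale (r (f k)) (f k))"
      using t(3) K by (simp add: sum.reindex)
  qed (use K in simp)
qed

lemma (in banach_scaling) tendsto_scale:
  assumes "(f \<longlongrightarrow> c) F"
  shows "((\<lambda>x. sV (f x) v) \<longlongrightarrow> sV c v) F"
proof (rule LIM_zero_cancel)
  have "((\<lambda>x. norm (f x - c) * norm v) \<longlongrightarrow> 0 * norm v) F"
    by (intro tendsto_mult tendsto_const tendsto_norm_zero LIM_zero assms)
  then have "((\<lambda>x. norm (sV (f x - c) v)) \<longlongrightarrow> 0) F"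
    by (simp add: norm_scale)
  then have "((\<lambda>x. sV (f x - c) v) \<longlongrightarrow> 0) F"
    by (rule tendsto_norm_zero_cancel)
  then show "((\<lambda>x. sV (f x) v - sV c v) \<longlongrightarrow> 0) F"
    by (simp add: scale_left_diff_distrib)
qed

text \<open>Otherwise elements of the span converge to \<open>x\<close>. By \<open>bound\<close>
  their coefficients are Cauchy, hence convergent by completeness of the scalar field, and the
  limits express \<open>x\<close> as an element of the span.\<close>

lemma (in banach_scaling) dist_span_pos:
  assumes B: "finite B"
    and bound: "\<And>c. (\<Sum>b\<in>B. norm (c b)) \<le> \<Lambda> * norm (\<Sum>b\<in>B. sV (c b) b)"
    and x: "x \<notin> span B"
  obtains d where "d > 0" "\<And>v. v \<in> span B \<Longrightarrow> d \<le> norm (x - v)"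
proof (rule ccontr)
  assume "\<not> thesis"
  note ex = that
  then have "\<exists>v\<in>span B. norm (x - v) < d" if "d > 0" for d
    using ex[OF that] \<open>\<not> thesis\<close> by (meson not_less)
  then have "\<exists>v\<in>span B. norm (x - v) < inverse (real (Suc n))" for n
    by simp
  then obtain v where v: "\<And>n. v n \<in> span B" "\<And>n. norm (x - v n) < inverse (real (Suc n))"
    by metis
  have "(\<lambda>n. norm (v n - x)) \<longlonglongrightarrow> 0"
    by (rule tendsto_sandwich[OF _ _ tendsto_const LIMSEQ_inverse_real_of_nat])
      (use v(2) in \<open>auto simp: norm_minus_commute intro!: always_eventually less_imp_le\<close>)
  then have lim: "v \<longlonglongrightarrow> x"
    using LIM_zero_cancel tendsto_norm_zero_iff by blast
  have "\<exists>c. v n = (\<Sum>b\<in>B. sV (c b) b)" for n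
    using v(1)[of n] unfolding span_finite[OF B] by blast
  then obtain c where c: "\<And>n. v n = (\<Sum>b\<in>B. sV (c n b) b)"
    by metis
  have "convergent (\<lambda>n. c n b)" if "b \<in> B" for b
  proof (rule Cauchy_convergent, rule metric_CauchyI)
    fix e :: real assume "e > 0"
    \<comment> \<open>The sign of \<Lambda> is not prescribed here; its maximum with 1 may be
      divided by.\<close>
    define \<Lambda>' where "\<Lambda>' = max \<Lambda> 1"
    have "Cauchy v"
      using lim by (rule LIMSEQ_imp_Cauchy)
    then obtain M where M: "\<And>m n. m \<ge> M \<Longrightarrow> n \<ge> M \<Longrightarrow> dist (v m) (v n) < e / \<Lambda>'"
      using metric_CauchyD[of v "e / \<Lambda>'"] \<open>e > 0\<close> by (auto simp: \<Lambda>'_def)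
    have "dist (c m b) (c n b) < e" if "m \<ge> M" "n \<ge> M" for m n
    proof -
      have "dist (c m b) (c n b) \<le> (\<Sum>b\<in>B. norm (c m b - c n b))"
        unfolding dist_norm using B \<open>b \<in> B\<close> by (intro member_le_sum) auto
      also have "\<dots> \<le> \<Lambda> * norm (v m - v n)"
        using bound[of "\<lambda>b. c m b - c n b"] by (simp add: c scale_left_diff_distrib sum_subtractf)
      also have "\<dots> \<le> \<Lambda>' * dist (v m) (v n)"
        by (simp add: dist_norm \<Lambda>'_def mult_right_mono)
      also have "\<dots> < e"
        using M[OF that] by (simp add: \<Lambda>'_def field_simps)
      finally show ?thesis .
    qed
    then show "\<exists>M. \<forall>m\<ge>M. \<forall>n\<ge>M. dist (c m b) (c n b) < e"
      by blast
  qed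
  then have "\<exists>l. (\<lambda>n. c n b) \<longlonglongrightarrow> l" if "b \<in> B" for b
    using that by (auto simp: convergent_def)
  then obtain l where l: "\<And>b. b \<in> B \<Longrightarrow> (\<lambda>n. c n b) \<longlonglongrightarrow> l b"
    by metis
  have "v \<longlonglongrightarrow> (\<Sum>b\<in>B. sV (l b) b)"
    unfolding c by (intro tendsto_sum tendsto_scale l)
  then have "x = (\<Sum>b\<in>B. sV (l b) b)"
    using lim LIMSEQ_unique by blast
  then show False
    using x by (auto intro: span_sum span_scale span_base)
qed

text \<open>Induction on \<open>B\<close>: the positive distance from the new vector to the old span
  controls the new coefficient, and the induction hypothesis controls the others.\<close>

lemma (in banach_scaling) independent_coeff_bound:
  assumes "finite B" "independent B"
  obtains \<Lambda> where "\<Lambda> \<ge> 0"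
    "\<And>c. (\<Sum>b\<in>B. norm (c b)) \<le> \<Lambda> * norm (\<Sum>b\<in>B. sV (c b) b)"
proof -
  have "\<exists>\<Lambda>\<ge>0. \<forall>c. (\<Sum>b\<in>B. norm (c b)) \<le> \<Lambda> * norm (\<Sum>b\<in>B. sV (c b) b)"
    using assms
  proof (induction B rule: finite_induct)
    case empty
    then show ?case by (auto intro: exI[of _ 0])
  next
    case (insert x B)
    then have "independent B" "x \<notin> span B"
      by (auto simp: independent_insert)
    then obtain \<Lambda> where \<Lambda>: "\<Lambda> \<ge> 0" "\<And>c. (\<Sum>b\<in>B. norm (c b)) \<le> \<Lambda> * norm (\<Sum>b\<in>B. sV (c b) b)"
      using insert.IH by blast
    obtain d where d: "d > 0" "\<And>v. v \<in> span B \<Longrightarrow> d \<le> norm (x - v)"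
      using dist_span_pos[OF insert.hyps(1) \<Lambda>(2) \<open>x \<notin> span B\<close>] by blast
    \<comment> \<open>The summand \<open>1 / d\<close> pays for the coefficient of \<open>x\<close>.
      The other one comes from applying \<Lambda> to \<open>u\<close>, whose norm is at most
      \<open>(1 + norm x / d) * norm v\<close>.\<close>
    show ?case
    proof (intro exI[of _ "1 / d + \<Lambda> * (1 + norm x / d)"] conjI allI)
      show "0 \<le> 1 / d + \<Lambda> * (1 + norm x / d)"
        using \<Lambda>(1) d(1) by simp
      fix c
      define u where "u = (\<Sum>b\<in>B. sV (c b) b)"
      define v where "v = sV (c x) x + u"
      have "u \<in> span B"
        unfolding u_def by (intro span_sum span_scale span_base)
      have cx: "norm (c x) \<le> norm v / d"
      proof (cases "c x = 0")
        case False
        \<comment> \<open>With \<open>c x\<close> factored out, what remains is the difference of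
          \<open>x\<close> and an element of the span, of norm at least \<open>d\<close>.\<close>
        have "v = sV (c x) (x - sV (- inverse (c x)) u)"
          using False by (simp add: v_def scale_right_distrib)
        moreover have "d \<le> norm (x - sV (- inverse (c x)) u)"
          using \<open>u \<in> span B\<close> by (intro d(2) span_scale)
        ultimately have "norm (c x) * d \<le> norm v"
          by (simp add: norm_scale mult_left_mono)
        then show ?thesis
          using d(1) by (simp add: le_divide_eq)
      qed (use d in simp)
      have "norm u \<le> norm v + norm (sV (c x) x)"
        using norm_triangle_ineq4[of v "sV (c x) x"] by (simp add: v_def)
      also have "\<dots> \<le> norm v + norm v / d * norm x"
        using mult_right_mono[OF cx, of "norm x"] by (simp add: norm_scale)
      finally have "\<Lambda> * norm u \<le> \<Lambda> * (norm v + norm v / d * norm x)"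
        using \<Lambda>(1) by (rule mult_left_mono)
      moreover have "(\<Sum>b\<in>B. norm (c b)) \<le> \<Lambda> * norm u"
        using \<Lambda>(2) by (simp add: u_def)
      moreover have "(\<Sum>b\<in>insert x B. norm (c b)) = norm (c x) + (\<Sum>b\<in>B. norm (c b))"
        using insert.hyps by simp
      ultimately have "(\<Sum>b\<in>insert x B. norm (c b))
          \<le> norm v / d + \<Lambda> * (norm v + norm v / d * norm x)"
        using cx by linarith
      also have "\<dots> = (1 / d + \<Lambda> * (1 + norm x / d)) * norm v"
        by (simp add: algebra_simps)
      also have "v = (\<Sum>b\<in>insert x B. sV (c b) b)"
        using insert.hyps by (simp add: v_def u_def)
      finally show "(\<Sum>b\<in>insert x B. norm (c b))
          \<le> (1 / d + \<Lambda> * (1 + norm x / d)) * norm (\<Sum>b\<in>insert x B. sV (c b) b)" .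
    qed
  qed
  then show ?thesis
    using that by blast
qed

text \<open>The estimates for combinations are needed both in \<open>V\<close>, with carrier
  \<open>UNIV\<close>, and in each of the finite-dimensional spaces; both are made instances of the
  same locale.\<close>

sublocale banach_scaling \<subseteq> normed_subspace sV UNIV norm
  by unfold_locales
    (auto simp: norm_on_def norm_scale norm_triangle_ineq)

sublocale fd_normed_space \<subseteq> normed_subspace sW U N
  by unfold_locales (fact subspace_U norm_N)+

subsection \<open>Words in the group\<close>

lemma finite_group_words: "finite F \<Longrightarrow> finite (group_words F m)"
proof -
  assume "finite F"
  then have "finite {w. set w \<subseteq> F \<and> length w \<le> m}"
    by (rule finite_lists_length_le)
  then show ?thesis
    by (rule rev_finite_subset) (auto simp: group_words_def)
qed

context uniformly_bounded_action
begin

lemma act_one [simp]: "act \<one> v = v"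
  using id_eq_one by (metis UNIV_I restrict_apply')

lemma linear_on_word: "set w \<subseteq> carrier G \<Longrightarrow> linear_on sV sV UNIV UNIV (foldr act w)"
proof (induction w)
  case (Cons g w)
  then interpret Vector_Spaces.linear sV sV "act g"
    using act_linear by simp
  show ?case
    using Cons by (simp add: linear_on_def add scale)
qed (simp add: linear_on_def)

lemma word_eq_act:
  assumes "set w \<subseteq> carrier G"
  obtains g where "g \<in> carrier G" "\<And>v. foldr act w v = act g v"
proof -
  interpret group G
    using group_hom by (rule group_hom.axioms(1))
  have "\<exists>g\<in>carrier G. \<forall>v. foldr act w v = act g v"
    using assms
  proof (induction w)
    case Nil
    then show ?case by (intro bexI[of _ "\<one>"]) auto
  next
    case (Cons h w)
    then obtain g where g: "g \<in> carrier G" "\<forall>v. foldr act w v = act g v"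
      by auto
    then show ?case
      using Cons.prems composition_rule[of _ h g] by (intro bexI[of _ "h \<otimes> g"]) auto
  qed
  then show ?thesis
    using that by blast
qed

text \<open>A word acts as a single group element, so the uniform bound does not depend on its
  length. Taking \<open>C \<ge> 1\<close> allows division by \<open>C\<close> later.\<close>

lemma word_bounded:
  obtains C where "C \<ge> 1" "\<And>w v. set w \<subseteq> carrier G \<Longrightarrow> norm (foldr act w v) \<le> C * norm v"
proof -
  obtain C where C: "\<And>g v. g \<in> carrier G \<Longrightarrow> norm (act g v) \<le> C * norm v"
    using act_bounded by blast
  show ?thesis
  proof (rule that[of "max C 1"])
    fix w v assume "set w \<subseteq> carrier G"
    then obtain g where "g \<in> carrier G" "\<And>v. foldr act w v = act g v"
      using word_eq_act by blast
    then have "norm (foldr act w v) \<le> C * norm v"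
      using C by simp
    also have "\<dots> \<le> max C 1 * norm v"
      by (simp add: mult_right_mono)
    finally show "norm (foldr act w v) \<le> max C 1 * norm v" .
  qed simp
qed

text \<open>The combination is indexed by pairs of a group element and an index, not by vectors: the
  same coefficients will be used with \<open>\<sigma> g\<close> in place of
  \<open>act g\<close>.\<close>

lemma dynamically_generating_approx:
  assumes "dynamically_generating G sV act S" "e > 0"
  shows "\<exists>K c. finite K \<and> K \<subseteq> carrier G \<times> UNIV \<and>
    norm (x - (\<Sum>k\<in>K. sV (c k) (act (fst k) (S (snd k))))) \<le> e"
proof -
  let ?f = "\<lambda>k. act (fst k) (S (snd k))"
  have eq: "{act g (S j) | g j. g \<in> carrier G} = ?f ` (carrier G \<times> UNIV)"
    by force
  have "x \<in> closure (span (?f ` (carrier G \<times> UNIV)))"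
    using assms(1) unfolding dynamically_generating_def eq by simp
  then obtain y where y: "y \<in> span (?f ` (carrier G \<times> UNIV))" "dist y x < e"
    using assms(2) closure_approachable by blast
  obtain K c where "finite K" "K \<subseteq> carrier G \<times> UNIV" "y = (\<Sum>k\<in>K. sV (c k) (?f k))"
    using span_image_explicit[OF y(1)] by blast
  then show ?thesis
    using y(2) by (intro exI[of _ K] exI[of _ c]) (auto simp: dist_norm norm_minus_commute)
qed

end

section \<open>Words in the isometries of one space, and almost equivariant maps into it\<close>

locale action_with_isometries =
  V: uniformly_bounded_action G sV act + fd_normed_space sW U N
  for G :: "('g, 'm) monoid_scheme" (structure)
    and sV :: "'k::{real_normed_field,euclidean_space} \<Rightarrow> 'v::banach \<Rightarrow> 'v"
    and act :: "'g \<Rightarrow> 'v \<Rightarrow> 'v"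
    and sW :: "'k \<Rightarrow> 'w::ab_group_add \<Rightarrow> 'w"
    and U :: "'w set" and N :: "'w \<Rightarrow> real" +
  fixes \<sigma> :: "'g \<Rightarrow> 'w \<Rightarrow> 'w"
  assumes isometry: "g \<in> carrier G \<Longrightarrow> surj_isometry sW U N (\<sigma> g)"
begin

lemma isometry_word:
  assumes "set w \<subseteq> carrier G"
  shows "linear_on sW sW U U (foldr \<sigma> w)" and "x \<in> U \<Longrightarrow> N (foldr \<sigma> w x) = N x"
proof -
  have "linear_on sW sW U U (foldr \<sigma> w) \<and> (\<forall>x\<in>U. N (foldr \<sigma> w x) = N x)"
    using assms
  proof (induction w)
    case (Cons g w)
    then show ?case
      using isometry[of g] by (auto simp: surj_isometry_def linear_on_def)
  qed (simp add: linear_on_def)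
  then show "linear_on sW sW U U (foldr \<sigma> w)" and "x \<in> U \<Longrightarrow> N (foldr \<sigma> w x) = N x"
    by auto
qed

lemma word_in_U: "set w \<subseteq> carrier G \<Longrightarrow> x \<in> U \<Longrightarrow> foldr \<sigma> w x \<in> U"
  using isometry_word(1) by (auto simp: linear_on_def)

lemma word_diff:
  assumes "set w \<subseteq> carrier G" "x \<in> U" "y \<in> U"
  shows "N (foldr \<sigma> w x - foldr \<sigma> w y) = N (x - y)"
proof -
  have "x - y \<in> U" "x - y + y = x"
    using assms subspace_diff[OF subspace_U] by auto
  then have "foldr \<sigma> w x = foldr \<sigma> w (x - y) + foldr \<sigma> w y"
    using isometry_word(1)[OF assms(1)] assms(3) unfolding linear_on_def by metis
  then show ?thesis
    using isometry_word(2)[OF assms(1) \<open>x - y \<in> U\<close>] by simp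
qed

end

context action_with_isometries
begin

lemma word_in_V_span:
  "w \<in> group_words F m \<Longrightarrow> j < m \<Longrightarrow> foldr act w (S j) \<in> V_span sV act S F m"
  unfolding V_span_def by (intro V.span_base) blast

text \<open>The empty word is not in \<open>group_words\<close>, so \<open>S j\<close> enters as the
  value of the one-letter word \<open>[\<one>]\<close>.\<close>

lemma in_V_span:
  assumes "\<one> \<in> F" "j < m"
  shows "S j \<in> V_span sV act S F m"
  using word_in_V_span[of "[\<one>]" F m j S] assms by (simp add: group_words_def)

lemma subspace_V_span: "V.subspace (V_span sV act S F m)"
  unfolding V_span_def by (rule V.subspace_span)

lemma Hom_Gamma_in_U:
  assumes "T \<in> Hom_Gamma sV sW act U N \<sigma> S F m \<delta>" "\<one> \<in> F" "j < m"
  shows "T (S j) \<in> U"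
  using assms in_V_span by (fastforce simp: Hom_Gamma_def linear_on_def)

text \<open>Almost equivariance is applied to the words \<open>w @ [fst k]\<close>, which have
  length at most \<open>m\<close> because \<open>length w < m\<close>. Working with concatenated
  words avoids any comparison of \<sigma> on products. The word \<open>w\<close> may be
  empty.\<close>

lemma Hom_Gamma_comb:
  fixes c :: "'g \<times> nat \<Rightarrow> 'k"
  assumes T: "T \<in> Hom_Gamma sV sW act U N \<sigma> S F m \<delta>"
    and F: "F \<subseteq> carrier G" "\<one> \<in> F" and w: "set w \<subseteq> F" "length w < m" and K: "K \<subseteq> F \<times> {..<m}"
  defines "y \<equiv> (\<Sum>k\<in>K. sV (c k) (act (fst k) (S (snd k))))"
    and "\<xi> \<equiv> (\<Sum>k\<in>K. sW (c k) (\<sigma> (fst k) (T (S (snd k)))))"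
  shows "foldr act w y \<in> V_span sV act S F m" and "\<xi> \<in> U"
    and "N (T (foldr act w y) - foldr \<sigma> w \<xi>) \<le> (\<Sum>k\<in>K. norm (c k)) * \<delta>"
proof -
  let ?a = "\<lambda>k. foldr act (w @ [fst k]) (S (snd k))"
  let ?b = "\<lambda>k. foldr \<sigma> (w @ [fst k]) (T (S (snd k)))"
  have wG: "set w \<subseteq> carrier G"
    using w(1) F(1) by blast
  have words: "w @ [fst k] \<in> group_words F m" "snd k < m" "fst k \<in> carrier G" if "k \<in> K" for k
  proof -
    have "fst k \<in> F" "snd k < m"
      using subsetD[OF K that] by (simp_all add: mem_Times_iff)
    then show "w @ [fst k] \<in> group_words F m" "snd k < m" "fst k \<in> carrier G"
      using w F(1) by (auto simp: group_words_def)
  qed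
  have a: "?a k \<in> V_span sV act S F m" if "k \<in> K" for k
    using words[OF that] by (intro word_in_V_span)
  have TU: "T (S (snd k)) \<in> U" if "k \<in> K" for k
    using words[OF that] F(2) by (intro Hom_Gamma_in_U[OF T])
  have \<sigma>U: "\<sigma> (fst k) (T (S (snd k))) \<in> U" if "k \<in> K" for k
    using word_in_U[of "[fst k]", OF _ TU[OF that]] words[OF that] by simp
  have wy: "foldr act w y = (\<Sum>k\<in>K. sV (c k) (?a k))"
    unfolding y_def
    using V.linear_on_comb[OF V.vector_space_axioms V.subspace_UNIV V.linear_on_word[OF wG]]
    by simp
  show "foldr act w y \<in> V_span sV act S F m"
    unfolding wy by (intro V.subspace_sum V.subspace_scale subspace_V_span a)
  show "\<xi> \<in> U"
    unfolding \<xi>_def by (intro subspace_sum subspace_scale subspace_U \<sigma>U)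
  have w\<xi>: "foldr \<sigma> w \<xi> = (\<Sum>k\<in>K. sW (c k) (?b k))"
    unfolding \<xi>_def
    using linear_on_comb[OF vector_space_axioms subspace_U isometry_word(1)[OF wG] \<sigma>U]
    by simp
  have b: "?b k \<in> U" if "k \<in> K" for k
    using \<sigma>U[OF that] wG by (simp add: word_in_U)
  show "N (T (foldr act w y) - foldr \<sigma> w \<xi>) \<le> (\<Sum>k\<in>K. norm (c k)) * \<delta>"
    unfolding wy w\<xi>
  proof (rule linear_comb_approx[OF V.vector_space_axioms subspace_V_span _ a b])
    show "linear_on sV sW (V_span sV act S F m) U T"
      using T by (simp add: Hom_Gamma_def)
    show "N (T (?a k) - ?b k) \<le> \<delta>" if "k \<in> K" for k
      using T words[OF that] unfolding Hom_Gamma_def by (blast intro: less_imp_le)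
  qed
qed

end

subsection \<open>From almost equivariant maps to tuples\<close>

text \<open>The triple \<open>(F, m, \<delta>)\<close> belongs to maps on the span of
  \<open>S'\<close>, whereas \<open>F0\<close> and \<open>m0\<close> belong to tuples for
  \<open>S\<close>. The data \<open>K\<close>, \<open>c\<close> express each \<open>S j\<close> with
  \<open>j < m0\<close> through translates of \<open>S'\<close> up to \<eta>, with coefficient mass
  at most \<open>Q\<close>. The strict inequalities \<open>m0 < m\<close> and \<open>1 < m\<close>
  leave room to append one letter to the words over \<open>F0\<close> and to single letters.\<close>

locale Hom_transfer =
  action_with_isometries G sV act sW U N \<sigma>
  for G :: "('g, 'm) monoid_scheme" (structure)
    and sV :: "'k::{real_normed_field,euclidean_space} \<Rightarrow> 'v::banach \<Rightarrow> 'v"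
    and act :: "'g \<Rightarrow> 'v \<Rightarrow> 'v"
    and sW :: "'k \<Rightarrow> 'w::ab_group_add \<Rightarrow> 'w"
    and U :: "'w set" and N :: "'w \<Rightarrow> real"
    and \<sigma> :: "'g \<Rightarrow> 'w \<Rightarrow> 'w" +
  fixes S S' :: "nat \<Rightarrow> 'v" and F F0 :: "'g set" and m m0 :: nat and \<delta> :: real
    and K :: "nat \<Rightarrow> ('g \<times> nat) set" and c :: "nat \<Rightarrow> 'g \<times> nat \<Rightarrow> 'k"
    and C \<eta> Q :: real
  assumes F: "F \<subseteq> carrier G" "\<one> \<in> F" "F0 \<subseteq> F"
    and m: "m0 < m" "1 < m"
    and K: "\<And>j. j < m0 \<Longrightarrow> K j \<subseteq> F \<times> {..<m}"
    and Q: "\<And>j. j < m0 \<Longrightarrow> (\<Sum>k\<in>K j. norm (c j k)) \<le> Q"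
    and C: "\<And>w v. set w \<subseteq> carrier G \<Longrightarrow> norm (foldr act w v) \<le> C * norm v"
    and \<eta>: "\<And>j. j < m0 \<Longrightarrow>
      norm (S j - (\<Sum>k\<in>K j. sV (c j k) (act (fst k) (S' (snd k))))) \<le> \<eta>"
    and nonneg: "0 \<le> C" "0 \<le> \<eta>" "0 \<le> Q" "0 \<le> \<delta>"
begin

definition approx_point :: "nat \<Rightarrow> 'v"
  where "approx_point j = (\<Sum>k\<in>K j. sV (c j k) (act (fst k) (S' (snd k))))"

definition transfer :: "('v \<Rightarrow> 'w) \<Rightarrow> nat \<Rightarrow> 'w"
  where "transfer T j =
    (if j < m0 then \<Sum>k\<in>K j. sW (c j k) (\<sigma> (fst k) (T (S' (snd k)))) else 0)"

lemma approx_point_diff: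
  assumes "j < m0" "set w \<subseteq> carrier G"
  shows "norm (foldr act w (approx_point j) - foldr act w (S j)) \<le> C * \<eta>"
proof -
  have "foldr act w (approx_point j) = foldr act w (approx_point j - S j) + foldr act w (S j)"
    using V.linear_on_word[OF assms(2)] unfolding linear_on_def by (metis UNIV_I diff_add_cancel)
  then have "norm (foldr act w (approx_point j) - foldr act w (S j)) \<le> C * norm (approx_point j - S j)"
    using C[OF assms(2)] by simp
  also have "\<dots> \<le> C * \<eta>"
    using \<eta>[OF assms(1)] nonneg(1) by (simp add: approx_point_def norm_minus_commute mult_left_mono)
  finally show ?thesis .
qed

context
  fixes T
  assumes T: "T \<in> Hom_Gamma sV sW act U N \<sigma> S' F m \<delta>"
begin

lemma transfer_in_U: "transfer T j \<in> U"
  using Hom_Gamma_comb(2)[OF T F(1,2) _ _ K[of j], of "[]"] m subspace_0[OF subspace_U]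
  by (simp add: transfer_def)

lemma
  assumes "set w \<subseteq> F" "length w < m" "j < m0"
  shows word_approx_point: "foldr act w (approx_point j) \<in> V_span sV act S' F m"
    and transfer_word: "N (T (foldr act w (approx_point j)) - foldr \<sigma> w (transfer T j)) \<le> Q * \<delta>"
proof -
  note * = Hom_Gamma_comb[OF T F(1,2) assms(1,2) K[OF assms(3)], of "c j"]
  show "foldr act w (approx_point j) \<in> V_span sV act S' F m"
    using *(1) by (simp add: approx_point_def)
  have "N (T (foldr act w (approx_point j)) - foldr \<sigma> w (transfer T j))
      \<le> (\<Sum>k\<in>K j. norm (c j k)) * \<delta>"
    using *(3) assms(3) by (simp add: approx_point_def transfer_def)
  also have "\<dots> \<le> Q * \<delta>"
    using Q[OF assms(3)] nonneg by (intro mult_right_mono)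
  finally show "N (T (foldr act w (approx_point j)) - foldr \<sigma> w (transfer T j)) \<le> Q * \<delta>" .
qed

lemma T_linear: "linear_on sV sW (V_span sV act S' F m) U T"
  and T_norm: "v \<in> V_span sV act S' F m \<Longrightarrow> N (T v) \<le> norm v"
  using T by (simp_all add: Hom_Gamma_def)

text \<open>For coefficients of total mass at most 1, the combination \<open>?z\<close> of the tuple
  is within \<open>Q * \<delta>\<close> of \<open>T ?y\<close>. As \<open>T\<close> is contractive,
  \<open>N (T ?y)\<close> is at most \<open>norm ?y\<close>, and \<open>?y\<close> is within
  \<open>C * \<eta>\<close> of the combination \<open>?x\<close> of the \<open>S j\<close>.\<close>

lemma transfer_in_Vect:
  assumes "C * \<eta> + Q * \<delta> \<le> \<delta>0"
  shows "transfer T \<in> Vect_Gamma sV sW act U N \<sigma> S F0 m0 \<delta>0"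
proof -
  have "N (\<Sum>w\<in>group_words F0 m0. \<Sum>j<m0. sW (d w j) (foldr \<sigma> w (transfer T j)))
        \<le> \<delta>0 + norm (\<Sum>w\<in>group_words F0 m0. \<Sum>j<m0. sV (d w j) (foldr act w (S j)))"
    if d: "(\<Sum>w\<in>group_words F0 m0. \<Sum>j<m0. norm (d w j)) \<le> 1" for d
  proof -
    let ?I = "group_words F0 m0 \<times> {..<m0}"
    let ?d = "\<lambda>p. d (fst p) (snd p)"
    let ?x = "\<Sum>p\<in>?I. sV (?d p) (foldr act (fst p) (S (snd p)))"
    let ?y = "\<Sum>p\<in>?I. sV (?d p) (foldr act (fst p) (approx_point (snd p)))"
    let ?z = "\<Sum>p\<in>?I. sW (?d p) (foldr \<sigma> (fst p) (transfer T (snd p)))"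
    have p: "set (fst p) \<subseteq> F" "length (fst p) < m" "snd p < m0" "set (fst p) \<subseteq> carrier G"
      if "p \<in> ?I" for p
      using that F(1,3) m(1) by (auto simp: group_words_def subset_iff)
    have d1: "(\<Sum>p\<in>?I. norm (?d p)) \<le> 1"
      using d by (simp add: sum.cartesian_product split_beta)
    have zU: "?z \<in> U"
      by (intro subspace_sum subspace_scale subspace_U word_in_U transfer_in_U p)
    have yV: "?y \<in> V_span sV act S' F m"
      by (intro V.subspace_sum V.subspace_scale subspace_V_span word_approx_point p)
    then have TyU: "T ?y \<in> U"
      using T_linear by (simp add: linear_on_def)
    have "N (T ?y - ?z) \<le> (\<Sum>p\<in>?I. norm (?d p)) * (Q * \<delta>)"
      by (intro linear_comb_approx[OF V.vector_space_axioms subspace_V_span T_linear]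
          word_approx_point word_in_U transfer_in_U transfer_word p)
    moreover have "norm (?y - ?x) \<le> (\<Sum>p\<in>?I. norm (?d p)) * (C * \<eta>)"
      by (intro V.linear_comb_approx[OF V.vector_space_axioms V.subspace_UNIV V.linear_on_id]
          approx_point_diff p UNIV_I)
    ultimately have "N (T ?y - ?z) \<le> Q * \<delta>" "norm (?y - ?x) \<le> C * \<eta>"
      using mult_right_mono[OF d1, of "Q * \<delta>"] mult_right_mono[OF d1, of "C * \<eta>"] nonneg
      by simp_all
    moreover have "N ?z \<le> N (?z - T ?y) + N (T ?y - 0)"
      using N_diff_triangle[OF zU TyU subspace_0[OF subspace_U]] by simp
    moreover have "N (T ?y) \<le> norm ?y"
      using yV by (rule T_norm)
    moreover have "norm ?y \<le> norm (?y - ?x) + norm ?x"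
      using norm_triangle_sub[of ?y ?x] by simp
    ultimately have "N ?z \<le> \<delta>0 + norm ?x"
      using assms N_minus_commute[OF zU TyU] by simp
    then show ?thesis
      by (simp add: sum.cartesian_product split_beta)
  qed
  then show ?thesis
    using transfer_in_U by (simp add: Vect_Gamma_def) (simp add: transfer_def)
qed

text \<open>Each summand pays for one replacement: \<theta> for \<open>S' n\<close> by a combination
  of translates of the \<open>S j\<close>, \<open>A * (C * \<eta>)\<close> for \<open>S j\<close> by
  \<open>approx_point j\<close>, \<open>A * (Q * \<delta>)\<close> for passing from \<open>T\<close>
  to \<sigma>, and \<open>A * \<kappa>\<close> for the tuple by \<open>w\<close>, which the
  isometries do not enlarge.\<close>

lemma transfer_recover:
  assumes n: "n < m" and D: "D \<subseteq> F \<times> {..<m0}" and A: "(\<Sum>k\<in>D. norm (d k)) \<le> A" "0 \<le> A"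
    and dn: "norm (S' n - (\<Sum>k\<in>D. sV (d k) (act (fst k) (S (snd k))))) \<le> \<theta>"
    and w: "\<And>j. w j \<in> U" "\<And>k. k \<in> D \<Longrightarrow> N (transfer T (snd k) - w (snd k)) \<le> \<kappa>" "0 \<le> \<kappa>"
  shows "N (T (S' n) - (\<Sum>k\<in>D. sW (d k) (\<sigma> (fst k) (w (snd k)))))
    \<le> \<theta> + A * (C * \<eta>) + A * (Q * \<delta>) + A * \<kappa>"
proof -
  let ?x = "\<Sum>k\<in>D. sV (d k) (act (fst k) (S (snd k)))"
  let ?y = "\<Sum>k\<in>D. sV (d k) (act (fst k) (approx_point (snd k)))"
  let ?\<xi> = "\<Sum>k\<in>D. sW (d k) (\<sigma> (fst k) (transfer T (snd k)))"
  let ?w = "\<Sum>k\<in>D. sW (d k) (\<sigma> (fst k) (w (snd k)))"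
  have k: "set [fst k] \<subseteq> F" "length [fst k] < m" "snd k < m0" "set [fst k] \<subseteq> carrier G"
    if "k \<in> D" for k
    using subsetD[OF D that] F(1) m(2) by (auto simp: mem_Times_iff)
  note word = word_approx_point[OF k(1-3), simplified] transfer_word[OF k(1-3), simplified]
    word_in_U[OF k(4) transfer_in_U, simplified] word_in_U[OF k(4) w(1), simplified]
    approx_point_diff[OF k(3,4), simplified] word_diff[OF k(4) transfer_in_U w(1), simplified]
  have x: "S' n \<in> V_span sV act S' F m"
    by (rule in_V_span[OF F(2) n])
  have y: "?y \<in> V_span sV act S' F m"
    by (intro V.subspace_sum V.subspace_scale subspace_V_span word)
  have xy: "S' n - ?y \<in> V_span sV act S' F m"
    by (rule V.subspace_diff[OF subspace_V_span x y])
  have TU: "T (S' n) \<in> U" "T ?y \<in> U"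
    using x y T_linear by (auto simp: linear_on_def)
  have U: "?\<xi> \<in> U" "?w \<in> U"
    by (intro subspace_sum subspace_scale subspace_U word; assumption)+
  have "T (S' n - ?y + ?y) = T (S' n - ?y) + T ?y"
    by (rule T_linear[unfolded linear_on_def, THEN conjunct2, THEN conjunct1, rule_format, OF xy y])
  then have "N (T (S' n) - T ?y) \<le> norm (S' n - ?y)"
    using T_norm[OF xy] by simp
  also have "\<dots> \<le> norm (S' n - ?x) + norm (?y - ?x)"
    using norm_triangle_ineq[of "S' n - ?x" "?x - ?y"] by (simp add: norm_minus_commute)
  also have "norm (?y - ?x) \<le> (\<Sum>k\<in>D. norm (d k)) * (C * \<eta>)"
    by (rule V.linear_comb_approx[OF V.vector_space_axioms V.subspace_UNIV V.linear_on_id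
          UNIV_I UNIV_I word(5)])
  finally have 1: "N (T (S' n) - T ?y) \<le> \<theta> + A * (C * \<eta>)"
    using dn mult_right_mono[OF A(1), of "C * \<eta>"] nonneg by simp
  have "N (T ?y - ?\<xi>) \<le> (\<Sum>k\<in>D. norm (d k)) * (Q * \<delta>)"
    by (rule linear_comb_approx[OF V.vector_space_axioms subspace_V_span T_linear word(1,3,2)])
  then have 2: "N (T ?y - ?\<xi>) \<le> A * (Q * \<delta>)"
    using mult_right_mono[OF A(1), of "Q * \<delta>"] nonneg by simp
  have "N (?\<xi> - ?w) \<le> (\<Sum>k\<in>D. norm (d k)) * \<kappa>"
    by (rule linear_comb_approx[OF vector_space_axioms subspace_U linear_on_id word(3,4)])
      (simp_all add: word(6) w(2))
  then have 3: "N (?\<xi> - ?w) \<le> A * \<kappa>"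
    using mult_right_mono[OF A(1) w(3)] by simp
  show ?thesis
    using 1 2 3 N_diff_triangle[OF TU U(1)] N_diff_triangle[OF TU(1) U] by linarith
qed

end

end

section \<open>Recovering a map from its tuple, and the resulting comparison of dimensions\<close>

context action_with_isometries
begin

text \<open>\<open>L\<close> does not involve any \<open>T\<close>, so one linear map serves all of
  \<open>Hom_Gamma\<close>. Its values vanish from \<open>M\<close> on and are therefore bounded
  sequences.\<close>

lemma recovery_linear:
  fixes d :: "nat \<Rightarrow> 'g \<times> nat \<Rightarrow> 'k"
  assumes D: "\<And>n. n < M \<Longrightarrow> D n \<subseteq> carrier G \<times> UNIV"
  defines "L \<equiv> \<lambda>\<zeta> n. if n < M then \<Sum>k\<in>D n. sW (d n k) (\<sigma> (fst k) (\<zeta> (snd k))) else 0"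
  shows "linear_on (seq_scale sW) (seq_scale sW) (ell_inf U N) (ell_inf U N) L"
proof -
  have \<sigma>U: "\<sigma> (fst k) x \<in> U" if "k \<in> D n" "n < M" "x \<in> U" for k n x
    using word_in_U[of "[fst k]" x] D[OF that(2)] that by auto
  have \<sigma>: "\<sigma> (fst k) (x + y) = \<sigma> (fst k) x + \<sigma> (fst k) y"
    if "k \<in> D n" "n < M" "x \<in> U" "y \<in> U" for k n x y
    using isometry_word(1)[of "[fst k]"] D[OF that(2)] that by (auto simp: linear_on_def)
  have \<sigma>': "\<sigma> (fst k) (sW a x) = sW a (\<sigma> (fst k) x)"
    if "k \<in> D n" "n < M" "x \<in> U" for k n x a
    using isometry_word(1)[of "[fst k]"] D[OF that(2)] that by (auto simp: linear_on_def)
  have LU: "L \<zeta> n \<in> U" if "\<zeta> \<in> ell_inf U N" for \<zeta> n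
    unfolding L_def using that
    by (auto simp: ell_inf_def intro!: subspace_sum subspace_scale subspace_U \<sigma>U
        subspace_0[OF subspace_U])
  have "L \<zeta> \<in> ell_inf U N" if "\<zeta> \<in> ell_inf U N" for \<zeta>
    using LU[OF that] by (rule ell_inf_finite_support[of _ M]) (simp add: L_def)
  moreover have "L (\<zeta> + \<xi>) = L \<zeta> + L \<xi>" if "\<zeta> \<in> ell_inf U N" "\<xi> \<in> ell_inf U N" for \<zeta> \<xi>
  proof
    fix n
    show "L (\<zeta> + \<xi>) n = (L \<zeta> + L \<xi>) n"
      using that
      by (auto simp: L_def ell_inf_def \<sigma> scale_right_distrib simp flip: sum.distrib
          intro!: sum.cong)
  qed
  moreover have "L (seq_scale sW a \<zeta>) = seq_scale sW a (L \<zeta>)" if "\<zeta> \<in> ell_inf U N" for a \<zeta>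
  proof
    fix n
    show "L (seq_scale sW a \<zeta>) n = seq_scale sW a (L \<zeta>) n"
      using that
      by (auto simp: L_def ell_inf_def seq_scale_def \<sigma>' scale_sum_right mult.commute intro!: sum.cong)
  qed
  ultimately show ?thesis
    by (simp add: linear_on_def)
qed

lemma normalized_dim_le_linear:
  assumes "linear_on (seq_scale sW) (seq_scale sW) (ell_inf U N) (ell_inf U N) L"
    and "\<And>x. x \<in> A \<Longrightarrow> \<exists>y\<in>B. \<forall>w\<in>ell_inf U N.
      rho_V \<rho> N (y - w) < \<epsilon>' \<longrightarrow> rho_V \<rho>' N (x - L w) < \<epsilon>"
  shows "normalized_dim sW U N \<rho>' \<epsilon> A \<le> normalized_dim sW U N \<rho> \<epsilon>' B"
  unfolding normalized_dim_def divide_ereal_def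
  by (intro ereal_mult_right_mono eps_dim_le_linear[where L = L]
      vector_space_seq_scale subspace_ell_inf assms vector_space_axioms) simp_all

end

context Hom_transfer
begin

text \<open>Closeness \<open>\<epsilon>'\<close> in \<open>rho_V\<close> becomes closeness
  \<open>\<epsilon>' / r\<close> in the coordinates below \<open>J\<close>, the only ones read by
  \<open>L\<close>. The four errors of \<open>transfer_recover\<close> get \<theta>/4 each.\<close>

lemma normalized_dim_Hom_le_Vect:
  fixes \<rho> \<rho>' :: "(nat \<Rightarrow> 'k) \<Rightarrow> real" and d :: "nat \<Rightarrow> 'g \<times> nat \<Rightarrow> 'k"
  assumes \<rho>: "product_norm \<rho>"
    and S': "\<And>n. norm (S' n) \<le> R"
    and small: "\<And>f :: nat \<Rightarrow> 'k. (\<And>n. norm (f n) \<le> R) \<Longrightarrow> (\<And>n. n < M \<Longrightarrow> norm (f n) \<le> \<theta>)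
      \<Longrightarrow> \<rho>' f < \<epsilon>"
    and "\<theta> \<le> R" "M \<le> m" "J \<le> m0"
    and D: "\<And>n. n < M \<Longrightarrow> D n \<subseteq> F \<times> {..<J}" and A: "\<And>n. n < M \<Longrightarrow> (\<Sum>k\<in>D n. norm (d n k)) \<le> A"
      "0 \<le> A"
    and dn: "\<And>n. n < M \<Longrightarrow>
      norm (S' n - (\<Sum>k\<in>D n. sV (d n k) (act (fst k) (S (snd k))))) \<le> \<theta> / 4"
    and r: "0 < r" "\<And>j. j < J \<Longrightarrow> r \<le> \<rho> (\<lambda>n. if n = j then 1 else 0)"
    and le: "C * \<eta> + Q * \<delta> \<le> \<delta>0" "A * (C * \<eta>) \<le> \<theta> / 4" "A * (Q * \<delta>) \<le> \<theta> / 4"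
      "A * (\<epsilon>' / r) \<le> \<theta> / 4"
    and "0 < \<epsilon>'"
  shows "normalized_dim sW U N \<rho>' \<epsilon> (alpha S' m ` Hom_Gamma sV sW act U N \<sigma> S' F m \<delta>)
    \<le> normalized_dim sW U N \<rho> \<epsilon>' (Vect_Gamma sV sW act U N \<sigma> S F0 m0 \<delta>0)"
proof -
  define L where "L \<equiv> \<lambda>\<zeta> n. if n < M then \<Sum>k\<in>D n. sW (d n k) (\<sigma> (fst k) (\<zeta> (snd k))) else 0"
  interpret sS: vector_space "seq_scale sW"
    by (rule vector_space_seq_scale) (rule vector_space_axioms)
  have Lin: "linear_on (seq_scale sW) (seq_scale sW) (ell_inf U N) (ell_inf U N) L"
    unfolding L_def by (rule recovery_linear) (use D F(1) in blast)
  show ?thesis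
  proof (rule normalized_dim_le_linear[OF Lin], safe)
    fix T assume T: "T \<in> Hom_Gamma sV sW act U N \<sigma> S' F m \<delta>"
    have "rho_V \<rho>' N (alpha S' m T - L w) < \<epsilon>"
      if w: "w \<in> ell_inf U N" "rho_V \<rho> N (transfer T - w) < \<epsilon>'" for w
    proof -
      have tr: "transfer T \<in> ell_inf U N"
        using transfer_in_U[OF T] by (rule ell_inf_finite_support[of _ m0]) (simp add: transfer_def)
      have wU: "w j \<in> U" for j
        using w(1) by (auto simp: ell_inf_def)
      have LU: "L w n \<in> U" for n
        using Lin w(1) by (auto simp: linear_on_def ell_inf_def)
      have close: "N (transfer T j - w j) \<le> \<epsilon>' / r" if "j < J" for j
      proof -
        have "N (transfer T j - w j) * r \<le> N (transfer T j - w j) * \<rho> (\<lambda>n. if n = j then 1 else 0)"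
          by (intro mult_left_mono r(2)[OF that] N_nonneg subspace_diff subspace_U transfer_in_U[OF T] wU)
        also have "\<dots> \<le> rho_V \<rho> N (transfer T - w)"
          using rho_V_coord[OF \<rho> sS.subspace_diff[OF subspace_ell_inf tr w(1)], of j] by simp
        finally show ?thesis
          using w(2) r(1) by (simp add: le_divide_eq)
      qed
      have \<alpha>U: "alpha S' m T n \<in> U" for n
        using Hom_Gamma_in_U[OF T F(2)] subspace_0[OF subspace_U] by (simp add: alpha_def)
      have \<alpha>R: "N (alpha S' m T n) \<le> R" for n
      proof (cases "n < m")
        case True
        then show ?thesis
          using T_norm[OF T in_V_span[OF F(2) True]] S'[of n] by (simp add: alpha_def)
      next
        case False
        then show ?thesis
          using order_trans[OF norm_ge_zero S'[of 0]] by (simp add: alpha_def)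
      qed
      have main: "N (alpha S' m T n - L w n) \<le> \<theta>" if "n < M" for n
      proof -
        have "N (T (S' n) - (\<Sum>k\<in>D n. sW (d n k) (\<sigma> (fst k) (w (snd k)))))
            \<le> \<theta> / 4 + A * (C * \<eta>) + A * (Q * \<delta>) + A * (\<epsilon>' / r)"
          using \<open>M \<le> m\<close> \<open>J \<le> m0\<close> that D[OF that] r(1) \<open>0 < \<epsilon>'\<close>
          by (intro transfer_recover[OF T] A dn wU close) auto
        also have "\<dots> \<le> \<theta>"
          using le by linarith
        finally show ?thesis
          using that \<open>M \<le> m\<close> by (simp add: alpha_def L_def)
      qed
      show ?thesis
        unfolding rho_V_def
      proof (rule small)
        have nonneg: "0 \<le> N (alpha S' m T n - L w n)" for n
          by (intro N_nonneg subspace_diff subspace_U \<alpha>U LU)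
        show "norm (of_real (N ((alpha S' m T - L w) n)) :: 'k) \<le> \<theta>" if "n < M" for n
          using main[OF that] nonneg[of n] by simp
        \<comment> \<open>From \<open>M\<close> on, \<open>L w\<close> vanishes and the entry is
          that of \<open>alpha S' m T\<close>, bounded by \<open>R\<close>; below \<open>M\<close>
          the bound \<theta> is at most \<open>R\<close>.\<close>
        show "norm (of_real (N ((alpha S' m T - L w) n)) :: 'k) \<le> R" for n
          using main[of n] nonneg[of n] \<alpha>R[of n] \<open>\<theta> \<le> R\<close>
          by (cases "n < M") (simp_all add: L_def)
      qed
    qed
    then show "\<exists>y\<in>Vect_Gamma sV sW act U N \<sigma> S F0 m0 \<delta>0. \<forall>w\<in>ell_inf U N.
        rho_V \<rho> N (y - w) < \<epsilon>' \<longrightarrow> rho_V \<rho>' N (alpha S' m T - L w) < \<epsilon>"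
      using transfer_in_Vect[OF T le(1)] by blast
  qed
qed

end

section \<open>Limits along the triples and the inequality dim \<le> vdim\<close>

lemma Limsup_le_Liminf:
  fixes f :: "'a \<Rightarrow> 'c::complete_linorder" and g :: "'b \<Rightarrow> 'c"
  assumes "\<forall>\<^sub>F y in B. \<forall>\<^sub>F x in A. f x \<le> g y"
  shows "Limsup A f \<le> Liminf B g"
proof (rule Liminf_bounded)
  show "\<forall>\<^sub>F y in B. Limsup A f \<le> g y"
    using assms by eventually_elim (rule Limsup_bounded)
qed

lemma eventually_triples:
  assumes "finite H" "H \<subseteq> carrier G" "0 < e"
  shows "\<forall>\<^sub>F (F, m, \<delta>) in triples_at_top G.
    finite F \<and> F \<subseteq> carrier G \<and> H \<subseteq> F \<and> n \<le> m \<and> 0 < \<delta> \<and> \<delta> < e"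
proof -
  have 1: "\<forall>\<^sub>F F in finite_subsets_at_top (carrier G). finite F \<and> F \<subseteq> carrier G \<and> H \<subseteq> F"
    unfolding eventually_finite_subsets_at_top using assms by blast
  have 2: "\<forall>\<^sub>F \<delta> in at_right 0. 0 < \<delta> \<and> \<delta> < e"
    using assms(3) by (auto simp: eventually_at_right_field)
  show ?thesis
    unfolding triples_at_top_def
    by (rule eventually_mono[OF eventually_prodI[OF 1 eventually_prodI[OF eventually_ge_at_top[of n] 2]]])
      auto
qed

lemma bound_initial_segment:
  fixes f :: "nat \<Rightarrow> real"
  shows "\<exists>A>0. \<forall>n<M. f n \<le> A"
  by (rule exI[of _ "Max (insert 1 (f ` {..<M}))"]) (auto simp: Max_gr_iff)

text \<open>The order of choices matters. First \<epsilon> fixes \<theta>, \<open>M\<close>, the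
  recovery coefficients and \<epsilon>'; then a triple for \<open>S\<close> is given; only then are
  \<open>K\<close>, \<open>c\<close> and a lower bound for the triples for \<open>S'\<close> chosen.
  \<open>Limsup_le_Liminf\<close> needs exactly this order of quantifiers.\<close>

lemma dim_Sigma_le_vdim_Sigma:
  fixes G :: "('g, 'm) monoid_scheme" (structure)
    and sV :: "'k::{real_normed_field,euclidean_space} \<Rightarrow> 'v::banach \<Rightarrow> 'v"
    and sW :: "'k \<Rightarrow> 'w::ab_group_add \<Rightarrow> 'w"
    and \<rho> \<rho>' :: "(nat \<Rightarrow> 'k) \<Rightarrow> real"
  assumes act: "\<And>i. action_with_isometries G sV act sW (U i) (N i) (\<sigma> i)"
    and S': "dynamically_generating G sV act S'" and \<rho>': "product_norm \<rho>'"
    and S: "dynamically_generating G sV act S" and \<rho>: "product_norm \<rho>"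
  shows "dim_Sigma G sV sW act U N \<sigma> S' \<rho>' \<le> vdim_Sigma G sV sW act U N \<sigma> S \<rho>"
proof -
  interpret V: uniformly_bounded_action G sV act
    using act by (rule action_with_isometries.axioms(1))
  interpret group G
    using V.group_hom by (rule group_hom.axioms(1))
  obtain C where C: "1 \<le> C" "\<And>w v. set w \<subseteq> carrier G \<Longrightarrow> norm (foldr act w v) \<le> C * norm v"
    using V.word_bounded by blast
  obtain R where R: "0 < R" "\<And>n. norm (S' n) \<le> R"
    using S' unfolding dynamically_generating_def bounded_pos by blast
  have "\<exists>\<epsilon>'\<in>{0<..}. Limsup (triples_at_top G) (\<lambda>(F, m, \<delta>).
        limsup (\<lambda>i. normalized_dim sW (U i) (N i) \<rho>' \<epsilon>
         (alpha S' m ` Hom_Gamma sV sW act (U i) (N i) (\<sigma> i) S' F m \<delta>)))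
      \<le> Liminf (triples_at_top G) (\<lambda>(F, m, \<delta>).
       limsup (\<lambda>i. normalized_dim sW (U i) (N i) \<rho> \<epsilon>'
         (Vect_Gamma sV sW act (U i) (N i) (\<sigma> i) S F m \<delta>)))"
    if "0 < \<epsilon>" for \<epsilon>
  proof -
    obtain \<theta>0 M where small0: "0 < \<theta>0"
        "\<forall>f. (\<forall>n. norm (f n) \<le> R) \<longrightarrow> (\<forall>n<M. norm (f n) \<le> \<theta>0) \<longrightarrow> \<rho>' f < \<epsilon>"
      using product_norm_small[OF \<rho>' \<open>0 < \<epsilon>\<close> R(1)] by metis
    define \<theta> where "\<theta> = min \<theta>0 R"
    have \<theta>: "0 < \<theta>" "\<theta> \<le> R"
      using small0(1) R(1) by (auto simp: \<theta>_def)
    have small: "\<rho>' f < \<epsilon>" if "\<And>n. norm (f n) \<le> R" "\<And>n. n < M \<Longrightarrow> norm (f n) \<le> \<theta>" for f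
      using that by (intro small0(2)[rule_format]) (auto simp: \<theta>_def)
    have "\<forall>n. \<exists>D d. finite D \<and> D \<subseteq> carrier G \<times> UNIV \<and>
        norm (S' n - (\<Sum>k\<in>D. sV (d k) (act (fst k) (S (snd k))))) \<le> \<theta> / 4"
      using \<theta>(1) by (intro allI V.dynamically_generating_approx[OF S]) simp
    then obtain D d where "\<forall>n. finite (D n) \<and> D n \<subseteq> carrier G \<times> UNIV \<and>
        norm (S' n - (\<Sum>k\<in>D n. sV (d n k) (act (fst k) (S (snd k))))) \<le> \<theta> / 4"
      unfolding choice_iff by (elim exE)
    then have D: "\<And>n. finite (D n)" "\<And>n. D n \<subseteq> carrier G \<times> UNIV"
      "\<And>n. norm (S' n - (\<Sum>k\<in>D n. sV (d n k) (act (fst k) (S (snd k))))) \<le> \<theta> / 4"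
      by simp_all
    obtain A where A: "0 < A" "\<And>n. n < M \<Longrightarrow> (\<Sum>k\<in>D n. norm (d n k)) \<le> A"
      using bound_initial_segment[of M "\<lambda>n. \<Sum>k\<in>D n. norm (d n k)"] by blast
    have "finite (\<Union>n<M. snd ` D n)"
      using D(1) by simp
    then obtain J where J: "\<And>j. j \<in> (\<Union>n<M. snd ` D n) \<Longrightarrow> j < J"
      unfolding finite_nat_set_iff_bounded by blast
    \<comment> \<open>The smallest weight among the finitely many coordinates that the recovery map
      reads; the inserted 1 covers \<open>J = 0\<close>.\<close>
    define r where "r = Min (insert 1 ((\<lambda>j. \<rho> (\<lambda>n. if n = j then 1 else 0)) ` {..<J}))"
    have r: "0 < r" "\<And>j. j < J \<Longrightarrow> r \<le> \<rho> (\<lambda>n. if n = j then 1 else 0)"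
      using product_norm_coord_pos[OF \<rho>] by (auto simp: r_def)
    \<comment> \<open>Chosen so that \<open>A * (\<epsilon>' / r)\<close> equals
      \<open>\<theta> / 4\<close>.\<close>
    define \<epsilon>' where "\<epsilon>' = \<theta> * r / (4 * A)"
    have \<epsilon>': "0 < \<epsilon>'" "A * (\<epsilon>' / r) \<le> \<theta> / 4"
      using \<theta>(1) r(1) A(1) by (simp_all add: \<epsilon>'_def)
    \<comment> \<open>The triple for \<open>S\<close> need only be large enough for its tuples to
      contain the \<open>J\<close> entries that are read.\<close>
    show ?thesis
    proof (rule bexI[of _ \<epsilon>'], rule Limsup_le_Liminf,
        rule eventually_mono[OF eventually_triples[OF finite.emptyI empty_subsetI zero_less_one, where n = J]])
      show "\<epsilon>' \<in> {0<..}"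
        using \<epsilon>'(1) by simp
      fix t0 :: "'g set \<times> nat \<times> real"
      assume "case t0 of (F, m, \<delta>) \<Rightarrow>
        finite F \<and> F \<subseteq> carrier G \<and> {} \<subseteq> F \<and> J \<le> m \<and> 0 < \<delta> \<and> \<delta> < 1"
      then obtain F0 m0 \<delta>0 where t0: "t0 = (F0, m0, \<delta>0)"
        "finite F0" "F0 \<subseteq> carrier G" "J \<le> m0" "0 < \<delta>0"
        by (cases t0) auto
      \<comment> \<open>The first bound uses half of \<delta>0 for \<open>C * \<eta>\<close>,
        leaving the other half for \<open>Q * \<delta>\<close>; the second keeps the error in the
        recovery within \<theta>/4. The same split with \<open>Q\<close> in place of
        \<open>C\<close> gives \<delta>1 below.\<close>
      define \<eta> where "\<eta> = min (\<delta>0 / 2 / C) (\<theta> / 4 / A / C)"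
      have "0 < \<eta>" "\<eta> \<le> \<delta>0 / 2 / C" "\<eta> \<le> \<theta> / 4 / A / C"
        using C(1) A(1) \<theta>(1) t0(5) by (simp_all add: \<eta>_def)
      then have \<eta>: "0 < \<eta>" "C * \<eta> \<le> \<delta>0 / 2" "A * (C * \<eta>) \<le> \<theta> / 4"
        using C(1) A(1) by (simp_all add: field_simps)
      have "\<forall>j. \<exists>K c. finite K \<and> K \<subseteq> carrier G \<times> UNIV \<and>
          norm (S j - (\<Sum>k\<in>K. sV (c k) (act (fst k) (S' (snd k))))) \<le> \<eta>"
        by (intro allI V.dynamically_generating_approx[OF S' \<eta>(1)])
      then obtain K c where "\<forall>j. finite (K j) \<and> K j \<subseteq> carrier G \<times> UNIV \<and>
          norm (S j - (\<Sum>k\<in>K j. sV (c j k) (act (fst k) (S' (snd k))))) \<le> \<eta>"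
        unfolding choice_iff by (elim exE)
      then have K: "\<And>j. finite (K j)" "\<And>j. K j \<subseteq> carrier G \<times> UNIV"
        "\<And>j. norm (S j - (\<Sum>k\<in>K j. sV (c j k) (act (fst k) (S' (snd k))))) \<le> \<eta>"
        by simp_all
      obtain Q where Q: "0 < Q" "\<And>j. j < m0 \<Longrightarrow> (\<Sum>k\<in>K j. norm (c j k)) \<le> Q"
        using bound_initial_segment[of m0 "\<lambda>j. \<Sum>k\<in>K j. norm (c j k)"] by blast
      have "finite (\<Union>j<m0. snd ` K j)"
        using K(1) by simp
      then obtain m' where m': "\<And>j. j \<in> (\<Union>j<m0. snd ` K j) \<Longrightarrow> j < m'"
        unfolding finite_nat_set_iff_bounded by blast
      \<comment> \<open>All group elements that occur in either approximation, together with the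
        identity and \<open>F0\<close>.\<close>
      define F1 where "F1 = {\<one>} \<union> F0 \<union> (\<Union>n<M. fst ` D n) \<union> (\<Union>j<m0. fst ` K j)"
      have "fst ` D n \<subseteq> carrier G" "fst ` K j \<subseteq> carrier G" for n j
        using D(2)[of n] K(2)[of j] by auto
      then have F1: "finite F1" "F1 \<subseteq> carrier G"
        unfolding F1_def using t0(2,3) D(1) K(1) by (simp_all add: UN_subset_iff)
      define \<delta>1 where "\<delta>1 = min (\<delta>0 / 2 / Q) (\<theta> / 4 / A / Q)"
      have \<delta>1: "0 < \<delta>1" "\<delta>1 \<le> \<delta>0 / 2 / Q" "\<delta>1 \<le> \<theta> / 4 / A / Q"
        using Q(1) A(1) \<theta>(1) t0(5) by (simp_all add: \<delta>1_def)
      \<comment> \<open>The two successors yield \<open>1 < m\<close> and \<open>m0 < m\<close>; the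
        summands \<open>M\<close> and \<open>m'\<close> make room for the recovered coordinates and
        for the indices in \<open>K\<close>.\<close>
      have key: "limsup (\<lambda>i. normalized_dim sW (U i) (N i) \<rho>' \<epsilon>
            (alpha S' m ` Hom_Gamma sV sW act (U i) (N i) (\<sigma> i) S' F m \<delta>))
          \<le> limsup (\<lambda>i. normalized_dim sW (U i) (N i) \<rho> \<epsilon>'
            (Vect_Gamma sV sW act (U i) (N i) (\<sigma> i) S F0 m0 \<delta>0))"
        if F: "finite F" "F \<subseteq> carrier G" "F1 \<subseteq> F"
          and m: "Suc (Suc (m0 + M + m')) \<le> m" and \<delta>: "0 < \<delta>" "\<delta> < \<delta>1" for F m \<delta>
      proof -
        have "\<delta> \<le> \<delta>0 / 2 / Q" "\<delta> \<le> \<theta> / 4 / A / Q"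
          using \<delta>(2) \<delta>1 by simp_all
        then have Q\<delta>: "Q * \<delta> \<le> \<delta>0 / 2" "A * (Q * \<delta>) \<le> \<theta> / 4"
          using Q(1) A(1) by (simp_all add: field_simps)
        show ?thesis
        proof (intro Limsup_mono always_eventually allI)
          fix i
          interpret action_with_isometries G sV act sW "U i" "N i" "\<sigma> i"
            by (rule act)
          have K': "K j \<subseteq> F \<times> {..<m}" if "j < m0" for j
          proof
            fix p assume "p \<in> K j"
            then have "fst p \<in> F1" "snd p < m'"
              using that m'[of "snd p"] unfolding F1_def by blast+
            then show "p \<in> F \<times> {..<m}"
              using subsetD[OF F(3)] m by (simp add: mem_Times_iff)
          qed
          have D': "D n \<subseteq> F \<times> {..<J}" if "n < M" for n
          proof
            fix p assume "p \<in> D n"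
            then have "fst p \<in> F1" "snd p < J"
              using that J[of "snd p"] unfolding F1_def by blast+
            then show "p \<in> F \<times> {..<J}"
              using subsetD[OF F(3)] by (simp add: mem_Times_iff)
          qed
          have "\<one> \<in> F" "F0 \<subseteq> F"
            using F(3) unfolding F1_def by blast+
          interpret H: Hom_transfer G sV act sW "U i" "N i" "\<sigma> i" S S' F F0 m m0 \<delta> K c C \<eta> Q
            by unfold_locales (use \<open>\<one> \<in> F\<close> \<open>F0 \<subseteq> F\<close> F(2) m C Q \<eta>(1) \<delta>(1) K(3) K' in simp_all)
          show "normalized_dim sW (U i) (N i) \<rho>' \<epsilon>
              (alpha S' m ` Hom_Gamma sV sW act (U i) (N i) (\<sigma> i) S' F m \<delta>)
            \<le> normalized_dim sW (U i) (N i) \<rho> \<epsilon>'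
              (Vect_Gamma sV sW act (U i) (N i) (\<sigma> i) S F0 m0 \<delta>0)"
            by (rule H.normalized_dim_Hom_le_Vect[where M = M and D = D and d = d and J = J
                  and R = R and \<theta> = \<theta> and A = A and r = r])
              (use \<rho> R(2) small \<theta>(2) t0(4) D' A D(3) r \<epsilon>' m \<eta>(2,3) Q\<delta> in simp_all)
        qed
      qed
      show "\<forall>\<^sub>F t in triples_at_top G. (case t of (F, m, \<delta>) \<Rightarrow>
            limsup (\<lambda>i. normalized_dim sW (U i) (N i) \<rho>' \<epsilon>
              (alpha S' m ` Hom_Gamma sV sW act (U i) (N i) (\<sigma> i) S' F m \<delta>)))
          \<le> (case t0 of (F, m, \<delta>) \<Rightarrow>
            limsup (\<lambda>i. normalized_dim sW (U i) (N i) \<rho> \<epsilon>'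
              (Vect_Gamma sV sW act (U i) (N i) (\<sigma> i) S F m \<delta>)))"
        by (rule eventually_mono[OF eventually_triples[OF F1 \<delta>1(1),
              where n = "Suc (Suc (m0 + M + m'))"]]) (clarsimp simp: t0(1) key)
    qed
  qed
  then show ?thesis
    unfolding dim_Sigma_def vdim_Sigma_def by (intro SUP_mono) simp
qed

subsection \<open>From tuples to almost equivariant maps\<close>

text \<open>The basis is extracted from the generating family itself, and \<open>p\<close> remembers
  a word and an index for each basis vector, so a linear map can be prescribed through words in
  \<sigma>.\<close>

lemma (in uniformly_bounded_action) V_span_basis:
  assumes "finite F"
  obtains \<beta> p where "finite \<beta>" "independent \<beta>" "V_span sV act S F m = span \<beta>"
    "\<And>v. v \<in> \<beta> \<Longrightarrow> p v \<in> group_words F m \<times> {..<m}"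
    "\<And>v. v \<in> \<beta> \<Longrightarrow> foldr act (fst (p v)) (S (snd (p v))) = v"
proof -
  let ?I = "group_words F m \<times> {..<m}"
  let ?X = "\<lambda>q. foldr act (fst q) (S (snd q))"
  have eq: "{foldr act w (S j) | w j. w \<in> group_words F m \<and> j < m} = ?X ` ?I"
    by force
  obtain \<beta> where \<beta>: "\<beta> \<subseteq> ?X ` ?I" "independent \<beta>" "?X ` ?I \<subseteq> span \<beta>"
    using maximal_independent_subset by blast
  have "finite (?X ` ?I)"
    using assms finite_group_words by blast
  then have "finite \<beta>"
    using \<beta>(1) finite_subset by blast
  moreover have "V_span sV act S F m = span \<beta>"
    unfolding V_span_def eq
    using span_minimal[OF \<beta>(3) subspace_span] span_mono[OF \<beta>(1)] by (rule subset_antisym)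
  moreover have "\<forall>v\<in>\<beta>. \<exists>q. q \<in> ?I \<and> ?X q = v"
    using \<beta>(1) by blast
  then obtain p where "\<forall>v\<in>\<beta>. p v \<in> ?I \<and> ?X (p v) = v"
    unfolding bchoice_iff by blast
  ultimately show ?thesis
    using \<beta>(2) that[of \<beta> p] by simp
qed

context action_with_isometries
begin

text \<open>This is the homogeneous form of the defining inequality: coefficients of mass
  \<open>s\<close> are divided by \<open>s\<close>, so the error \<delta> is multiplied by
  \<open>s\<close>. The index type is arbitrary and \<open>p\<close> need not be injective.\<close>

lemma Vect_Gamma_comb:
  fixes c :: "'i \<Rightarrow> 'k"
  assumes \<xi>: "\<xi> \<in> Vect_Gamma sV sW act U N \<sigma> S F m \<delta>" and F: "finite F" "F \<subseteq> carrier G"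
    and K: "finite K" "\<And>k. k \<in> K \<Longrightarrow> p k \<in> group_words F m \<times> {..<m}"
  shows "N (\<Sum>k\<in>K. sW (c k) (foldr \<sigma> (fst (p k)) (\<xi> (snd (p k)))))
    \<le> \<delta> * (\<Sum>k\<in>K. norm (c k))
      + norm (\<Sum>k\<in>K. sV (c k) (foldr act (fst (p k)) (S (snd (p k)))))"
proof -
  let ?I = "group_words F m \<times> {..<m}"
  let ?X = "\<lambda>q. foldr act (fst q) (S (snd q))"
  let ?Y = "\<lambda>q. foldr \<sigma> (fst q) (\<xi> (snd q))"
  define s where "s = (\<Sum>k\<in>K. norm (c k))"
  have I: "finite ?I"
    using F(1) finite_group_words by blast
  have pK: "p ` K \<subseteq> ?I"
    using K(2) by blast
  show ?thesis
  proof (cases "s = 0")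
    case True
    then have "c k = 0" if "k \<in> K" for k
      using K(1) that by (simp add: s_def sum_nonneg_eq_0_iff)
    then show ?thesis by simp
  next
    case False
    then have s: "s > 0"
      using sum_nonneg[of K "\<lambda>k. norm (c k)"] by (simp add: s_def less_le)
    let ?t = "of_real (1 / s) :: 'k"
    have t: "norm ?t = 1 / s"
      using s by (simp only: norm_of_real) simp
    \<comment> \<open>Normalized coefficients, collected over the indices that name the pair
      \<open>(w, j)\<close>.\<close>
    define d where "d w j = ?t * (\<Sum>k\<in>{k\<in>K. p k = (w, j)}. c k)" for w j
    have "(\<Sum>w\<in>group_words F m. \<Sum>j<m. norm (d w j)) = (\<Sum>q\<in>?I. norm (d (fst q) (snd q)))"
      by (simp add: sum.cartesian_product split_beta)
    also have "\<dots> \<le> (\<Sum>q\<in>?I. 1 / s * (\<Sum>k\<in>{k\<in>K. p k = q}. norm (c k)))"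
      unfolding d_def prod.collapse norm_mult t using s
      by (intro sum_mono mult_left_mono norm_sum) simp
    also have "\<dots> = 1 / s * s"
      unfolding s_def sum_distrib_left[symmetric] sum.group[OF K(1) I pK] by simp
    finally have d1: "(\<Sum>w\<in>group_words F m. \<Sum>j<m. norm (d w j)) \<le> 1"
      using s by simp
    have V: "(\<Sum>w\<in>group_words F m. \<Sum>j<m. sV (d w j) (foldr act w (S j)))
        = sV ?t (\<Sum>k\<in>K. sV (c k) (?X (p k)))"
    proof -
      have "(\<Sum>w\<in>group_words F m. \<Sum>j<m. sV (d w j) (foldr act w (S j)))
          = (\<Sum>q\<in>?I. sV (d (fst q) (snd q)) (?X q))"
        by (simp add: sum.cartesian_product split_beta)
      also have "\<dots> = sV ?t (\<Sum>q\<in>?I. sV (\<Sum>k\<in>{k\<in>K. p k = q}. c k) (?X q))"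
        by (simp only: d_def prod.collapse V.scale_sum_right V.scale_scale)
      finally show ?thesis
        by (simp only: V.sum_group_scale[OF K(1) I pK])
    qed
    have W: "(\<Sum>w\<in>group_words F m. \<Sum>j<m. sW (d w j) (foldr \<sigma> w (\<xi> j)))
        = sW ?t (\<Sum>k\<in>K. sW (c k) (?Y (p k)))"
    proof -
      have "(\<Sum>w\<in>group_words F m. \<Sum>j<m. sW (d w j) (foldr \<sigma> w (\<xi> j)))
          = (\<Sum>q\<in>?I. sW (d (fst q) (snd q)) (?Y q))"
        by (simp add: sum.cartesian_product split_beta)
      also have "\<dots> = sW ?t (\<Sum>q\<in>?I. sW (\<Sum>k\<in>{k\<in>K. p k = q}. c k) (?Y q))"
        by (simp only: d_def prod.collapse scale_sum_right scale_scale)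
      finally show ?thesis
        by (simp only: sum_group_scale[OF K(1) I pK])
    qed
    let ?x = "\<Sum>k\<in>K. sV (c k) (?X (p k))"
    let ?y = "\<Sum>k\<in>K. sW (c k) (?Y (p k))"
    have "?y \<in> U"
    proof (intro subspace_sum subspace_scale subspace_U word_in_U)
      fix k assume "k \<in> K"
      then have "fst (p k) \<in> group_words F m" "snd (p k) < m"
        using K(2)[of k] by (auto simp: mem_Times_iff)
      then show "set (fst (p k)) \<subseteq> carrier G" "\<xi> (snd (p k)) \<in> U"
        using F(2) \<xi> by (auto simp: group_words_def Vect_Gamma_def)
    qed
    have "N (sW ?t ?y) \<le> \<delta> + norm (sV ?t ?x)"
      using \<xi> d1 unfolding Vect_Gamma_def mem_Collect_eq V[symmetric] W[symmetric] by blast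
    then have "1 / s * N ?y \<le> \<delta> + 1 / s * norm ?x"
      unfolding N_scale[OF \<open>?y \<in> U\<close>] V.norm_scale t .
    then show ?thesis
      using s by (simp add: field_simps flip: s_def)
  qed
qed

text \<open>\<open>T0\<close> is prescribed on the basis, and every other word is reached through a
  linear relation in \<open>V\<close>, which the tuple satisfies approximately. Bounded coordinates
  keep these relations under control, and \<open>T\<close> is \<open>T0\<close> scaled to a
  contraction.\<close>

lemma Vect_Gamma_near_Hom:
  assumes \<xi>: "\<xi> \<in> Vect_Gamma sV sW act U N \<sigma> S F m \<delta>'" and "0 < \<delta>'"
    and F: "finite F" "F \<subseteq> carrier G" "\<one> \<in> F" and m: "2 \<le> m"
    and \<beta>: "finite \<beta>" "V.independent \<beta>" "V_span sV act S F m = V.span \<beta>"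
    and p: "\<And>v. v \<in> \<beta> \<Longrightarrow> p v \<in> group_words F m \<times> {..<m}"
      "\<And>v. v \<in> \<beta> \<Longrightarrow> foldr act (fst (p v)) (S (snd (p v))) = v"
    and \<Lambda>: "\<Lambda> \<ge> 0" "\<And>c. (\<Sum>b\<in>\<beta>. norm (c b)) \<le> \<Lambda> * norm (\<Sum>b\<in>\<beta>. sV (c b) b)"
    and C: "1 \<le> C" "\<And>w v. set w \<subseteq> carrier G \<Longrightarrow> norm (foldr act w v) \<le> C * norm v"
    and R: "\<And>j. norm (S j) \<le> R"
    and \<delta>: "\<delta>' * (\<Lambda> * (C * R) + \<Lambda> * R + 4) < \<delta>"
  shows "\<exists>T\<in>Hom_Gamma sV sW act U N \<sigma> S F m \<delta>.
    \<forall>n. N (\<xi> n - alpha S m T n) \<le> \<delta>' * (2 * (\<Lambda> * R) + 3)"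
proof -
  let ?I = "group_words F m \<times> {..<m}"
  let ?X = "\<lambda>q. foldr act (fst q) (S (snd q))"
  let ?Y = "\<lambda>q. foldr \<sigma> (fst q) (\<xi> (snd q))"
  interpret P: vector_space_pair sV sW
    by unfold_locales
  note comb = Vect_Gamma_comb[OF \<xi> F(1,2)]
  have R0: "0 \<le> R"
    using order_trans[OF norm_ge_zero R[of 0]] .
  have I: "set (fst q) \<subseteq> carrier G" "snd q < m" if "q \<in> ?I" for q
    using that F(2) by (auto simp: group_words_def)
  have \<xi>U: "\<xi> j \<in> U" for j
    using \<xi> subspace_0[OF subspace_U] by (cases "j < m") (auto simp: Vect_Gamma_def)
  have YU: "?Y q \<in> U" if "q \<in> ?I" for q
    using I[OF that] \<xi>U by (intro word_in_U)
  obtain T0 where T0: "Vector_Spaces.linear sV sW T0" "\<And>v. v \<in> \<beta> \<Longrightarrow> T0 v = ?Y (p v)"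
    using P.linear_independent_extend[OF \<beta>(2), of "\<lambda>v. ?Y (p v)"] by blast
  interpret T0: Vector_Spaces.linear sV sW T0
    by (rule T0(1))
  have expand: "\<exists>a. v = (\<Sum>u\<in>\<beta>. sV (a u) u) \<and> T0 v = (\<Sum>u\<in>\<beta>. sW (a u) (?Y (p u)))
      \<and> (\<Sum>u\<in>\<beta>. norm (a u)) \<le> \<Lambda> * norm v" if v: "v \<in> V.span \<beta>" for v
  proof -
    obtain a where a: "v = (\<Sum>u\<in>\<beta>. sV (a u) u)"
      using v unfolding V.span_finite[OF \<beta>(1)] by blast
    then have "T0 v = (\<Sum>u\<in>\<beta>. sW (a u) (?Y (p u)))"
      by (simp add: T0.sum T0.scale T0(2))
    then show ?thesis
      using a \<Lambda>(2)[of a] by (intro exI[of _ a]) simp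
  qed
  have T0U: "T0 v \<in> U" if v: "v \<in> V.span \<beta>" for v
  proof -
    obtain a where "T0 v = (\<Sum>u\<in>\<beta>. sW (a u) (?Y (p u)))"
      using expand[OF v] by blast
    then show ?thesis
      using p(1) by (auto intro!: subspace_sum subspace_scale subspace_U YU)
  qed
  \<comment> \<open>The error in \<open>Vect_Gamma_comb\<close> is \<delta>' times the coefficient
    mass, and \<Lambda> bounds that mass by \<open>norm v\<close>.\<close>
  have T0_norm: "N (T0 v) \<le> (1 + \<Lambda> * \<delta>') * norm v" if v: "v \<in> V.span \<beta>" for v
  proof -
    obtain a where a: "v = (\<Sum>u\<in>\<beta>. sV (a u) u)" "T0 v = (\<Sum>u\<in>\<beta>. sW (a u) (?Y (p u)))"
      "(\<Sum>u\<in>\<beta>. norm (a u)) \<le> \<Lambda> * norm v"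
      using expand[OF v] by blast
    have "(\<Sum>u\<in>\<beta>. sV (a u) (?X (p u))) = v"
      using p(2) by (simp flip: a(1))
    then have "N (T0 v) \<le> \<delta>' * (\<Sum>u\<in>\<beta>. norm (a u)) + norm v"
      using comb[where p = p and K = \<beta> and c = a, OF \<beta>(1) p(1)] by (simp add: a(2))
    also have "\<dots> \<le> \<delta>' * (\<Lambda> * norm v) + norm v"
      using a(3) \<open>0 < \<delta>'\<close> by (simp add: mult_left_mono)
    finally show ?thesis
      by (simp add: algebra_simps)
  qed
  have X: "?X q \<in> V.span \<beta>" if "q \<in> ?I" for q
    using that word_in_V_span[of "fst q" F m "snd q" S] \<beta>(3) by (auto simp: mem_Times_iff)
  have T0_word: "N (T0 (?X q) - ?Y q) \<le> \<delta>' * (\<Lambda> * norm (?X q) + 1)" if q: "q \<in> ?I" for q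
  proof -
    obtain a where a: "?X q = (\<Sum>u\<in>\<beta>. sV (a u) u)" "T0 (?X q) = (\<Sum>u\<in>\<beta>. sW (a u) (?Y (p u)))"
      "(\<Sum>u\<in>\<beta>. norm (a u)) \<le> \<Lambda> * norm (?X q)"
      using expand[OF X[OF q]] by blast
    \<comment> \<open>The relation expressing \<open>?X q\<close> in the basis is completed by the
      pair \<open>q\<close> itself with coefficient -1, placed at \<open>None\<close> because
      \<open>q\<close> may already occur among the \<open>p u\<close>. The combination in
      \<open>V\<close> is then 0, and only the error term survives.\<close>
    define c where "c = case_option (-1) a"
    define p' where "p' = case_option q p"
    have fin: "finite (insert None (Some ` \<beta>))"
      using \<beta>(1) by simp
    have "p' k \<in> ?I" if "k \<in> insert None (Some ` \<beta>)" for k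
      using that p(1) q by (auto simp: p'_def)
    note comb[where p = p' and c = c, OF fin this]
    moreover have "(\<Sum>k\<in>insert None (Some ` \<beta>). sW (c k) (?Y (p' k))) = T0 (?X q) - ?Y q"
      using \<beta>(1) by (simp add: sum.reindex a(2) c_def p'_def)
    moreover have "(\<Sum>k\<in>insert None (Some ` \<beta>). sV (c k) (?X (p' k))) = 0"
      using \<beta>(1) p(2) by (simp add: sum.reindex a(1) c_def p'_def)
    moreover have "(\<Sum>k\<in>insert None (Some ` \<beta>). norm (c k)) = 1 + (\<Sum>u\<in>\<beta>. norm (a u))"
      using \<beta>(1) by (simp add: sum.reindex c_def)
    ultimately have "N (T0 (?X q) - ?Y q) \<le> \<delta>' * (1 + (\<Sum>u\<in>\<beta>. norm (a u)))"
      by simp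
    also have "\<dots> \<le> \<delta>' * (\<Lambda> * norm (?X q) + 1)"
      using a(3) \<open>0 < \<delta>'\<close> by simp
    finally show ?thesis .
  qed
  \<comment> \<open>The maps \<open>\<sigma>\<close> need not be unital, so \<open>\<xi> j\<close> is compared with \<open>\<sigma> \<one> (\<xi> j)\<close>
    through the relation between the words \<open>\<one>\<close> and \<open>\<one>\<one>\<close>.\<close>
  have unit: "N (\<xi> j - \<sigma> \<one> (\<xi> j)) \<le> 2 * \<delta>'" if j: "j < m" for j
  proof -
    have "set [\<one>] \<subseteq> carrier G"
      using F(2,3) by auto
    then have U: "\<sigma> \<one> (\<xi> j) \<in> U" "N (\<sigma> \<one> (\<xi> j) - \<sigma> \<one> (\<sigma> \<one> (\<xi> j))) = N (\<xi> j - \<sigma> \<one> (\<xi> j))"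
      using word_in_U[of "[\<one>]" "\<xi> j"] word_diff[of "[\<one>]" "\<xi> j" "\<sigma> \<one> (\<xi> j)"] \<xi>U by auto
    have "(if k then [\<one>] else [\<one>, \<one>], j) \<in> ?I" for k
      using F(3) m j by (simp add: group_words_def)
    note comb[where K = UNIV and p = "\<lambda>k. (if k then [\<one>] else [\<one>, \<one>], j)" and
        c = "\<lambda>k. if k then 1 else -1", OF _ this]
    then show ?thesis
      using U(2) by (simp add: UNIV_bool)
  qed
  \<comment> \<open>\<open>act \<one>\<close> fixes \<open>S j\<close>, so \<open>T0_word\<close>
    for \<open>[\<one>]\<close> contributes one \<delta>' besides the term with \<Lambda>;
    \<open>unit\<close> contributes two more.\<close>
  have T0_S: "N (\<xi> j - T0 (S j)) \<le> \<delta>' * (\<Lambda> * R + 3)" if j: "j < m" for j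
  proof -
    have q: "([\<one>], j) \<in> ?I"
      using F(3) m j by (simp add: group_words_def)
    have "N (\<xi> j - T0 (S j)) \<le> N (\<xi> j - \<sigma> \<one> (\<xi> j)) + N (\<sigma> \<one> (\<xi> j) - T0 (S j))"
      using N_diff_triangle[OF \<xi>U[of j] YU[OF q] T0U[OF X[OF q]]] by simp
    also have "N (\<sigma> \<one> (\<xi> j) - T0 (S j)) = N (T0 (S j) - \<sigma> \<one> (\<xi> j))"
      using N_minus_commute[OF YU[OF q] T0U[OF X[OF q]]] by simp
    also have "\<dots> \<le> \<delta>' * (\<Lambda> * norm (S j) + 1)"
      using T0_word[OF q] by simp
    also have "\<dots> \<le> \<delta>' * (\<Lambda> * R + 1)"
      using \<open>0 < \<delta>'\<close> \<Lambda>(1) R[of j] by (simp add: mult_left_mono)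
    finally show ?thesis
      using unit[OF j] by (simp add: algebra_simps)
  qed
  \<comment> \<open>The reciprocal of the bound in \<open>T0_norm\<close>.\<close>
  define t where "t = 1 / (1 + \<Lambda> * \<delta>')"
  have t: "0 < t" "t \<le> 1" "t * (1 + \<Lambda> * \<delta>') = 1"
    using add_pos_nonneg[OF zero_less_one, of "\<Lambda> * \<delta>'"] \<Lambda>(1) \<open>0 < \<delta>'\<close>
    by (auto simp: t_def divide_simps)
  define T where "T v = sW (of_real t) (T0 v)" for v
  have SV: "S j \<in> V.span \<beta>" if "j < m" for j
    using in_V_span[OF F(3) that, of S] \<beta>(3) by simp
  have "T \<in> Hom_Gamma sV sW act U N \<sigma> S F m \<delta>"
    unfolding Hom_Gamma_def mem_Collect_eq \<beta>(3)
  proof (intro conjI ballI allI impI)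
    show "linear_on sV sW (V.span \<beta>) U T"
      using T0U subspace_scale[OF subspace_U]
      by (simp add: linear_on_def T_def T0.add T0.scale scale_right_distrib mult.commute)
    show "N (T v) \<le> norm v" if v: "v \<in> V.span \<beta>" for v
    proof -
      have "N (T v) = t * N (T0 v)"
        using t(1) T0U[OF v] by (simp add: T_def N_scale)
      also have "\<dots> \<le> t * ((1 + \<Lambda> * \<delta>') * norm v)"
        using t(1) T0_norm[OF v] by (simp add: mult_left_mono)
      also have "\<dots> = norm v"
        using t(3) by (simp flip: mult.assoc)
      finally show ?thesis .
    qed
    fix w j assume wj: "w \<in> group_words F m" "j < m"
    then have q: "(w, j) \<in> ?I" by simp
    then have wG: "set w \<subseteq> carrier G"
      using I by force
    have TX: "T0 (foldr act w (S j)) \<in> U" and Y: "foldr \<sigma> w (\<xi> j) \<in> U"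
      using T0U[OF X[OF q]] YU[OF q] by simp_all
    have TS: "T0 (S j) \<in> U" "foldr \<sigma> w (T0 (S j)) \<in> U"
      using T0U[OF SV[OF wj(2)]] word_in_U[OF wG] by simp_all
    have "foldr \<sigma> w (T (S j)) = sW (of_real t) (foldr \<sigma> w (T0 (S j)))"
      using isometry_word(1)[OF wG] TS(1) by (simp add: T_def linear_on_def)
    then have "N (T (foldr act w (S j)) - foldr \<sigma> w (T (S j)))
        = N (sW (of_real t) (T0 (foldr act w (S j)) - foldr \<sigma> w (T0 (S j))))"
      by (simp add: T_def scale_right_diff_distrib)
    also have "\<dots> = t * N (T0 (foldr act w (S j)) - foldr \<sigma> w (T0 (S j)))"
      using t(1) subspace_diff[OF subspace_U TX TS(2)] by (simp add: N_scale)
    also have "\<dots> \<le> 1 * N (T0 (foldr act w (S j)) - foldr \<sigma> w (T0 (S j)))"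
      using t(2) N_nonneg[OF subspace_diff[OF subspace_U TX TS(2)]] by (intro mult_right_mono)
    also have "\<dots> \<le> N (T0 (foldr act w (S j)) - foldr \<sigma> w (\<xi> j))
        + N (foldr \<sigma> w (\<xi> j) - foldr \<sigma> w (T0 (S j)))"
      using N_diff_triangle[OF TX Y TS(2)] by simp
    also have "N (foldr \<sigma> w (\<xi> j) - foldr \<sigma> w (T0 (S j))) = N (\<xi> j - T0 (S j))"
      by (rule word_diff[OF wG \<xi>U TS(1)])
    also have "\<dots> \<le> \<delta>' * (\<Lambda> * R + 3)"
      by (rule T0_S[OF wj(2)])
    also have "N (T0 (foldr act w (S j)) - foldr \<sigma> w (\<xi> j))
        \<le> \<delta>' * (\<Lambda> * norm (foldr act w (S j)) + 1)"
      using T0_word[OF q] by simp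
    also have "norm (foldr act w (S j)) \<le> C * R"
      by (rule order_trans[OF C(2)[OF wG] mult_left_mono[OF R]]) (use C(1) in simp)
    finally have "N (T (foldr act w (S j)) - foldr \<sigma> w (T (S j)))
        \<le> \<delta>' * (\<Lambda> * (C * R) + 1) + \<delta>' * (\<Lambda> * R + 3)"
      using \<open>0 < \<delta>'\<close> \<Lambda>(1) by (simp add: mult_left_mono)
    then show "N (T (foldr act w (S j)) - foldr \<sigma> w (T (S j))) < \<delta>"
      using \<delta> by (simp add: algebra_simps)
  qed
  moreover have "N (\<xi> n - alpha S m T n) \<le> \<delta>' * (2 * (\<Lambda> * R) + 3)" for n
  proof (cases "n < m")
    case True
    have T0S: "T0 (S n) \<in> U"
      by (rule T0U[OF SV[OF True]])
    \<comment> \<open>Rescaling costs at most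
      \<open>(1 - t) * (1 + \<Lambda> * \<delta>') * R\<close>, which is
      \<open>\<Lambda> * \<delta>' * R\<close>. Together with \<open>T0_S\<close> this produces the
      factor 2 in the claim.\<close>
    have "T0 (S n) - T (S n) = sW (of_real (1 - t)) (T0 (S n))"
      by (simp add: T_def scale_left_diff_distrib)
    then have "N (T0 (S n) - T (S n)) = norm (of_real (1 - t) :: 'k) * N (T0 (S n))"
      by (simp only: N_scale[OF T0S])
    also have "\<dots> = (1 - t) * N (T0 (S n))"
      using t(2) by (simp only: norm_of_real)
    also have "\<dots> \<le> (1 - t) * ((1 + \<Lambda> * \<delta>') * R)"
      using t(2) T0_norm[OF SV[OF True]] R[of n] \<Lambda>(1) \<open>0 < \<delta>'\<close>
      by (intro mult_left_mono order_trans[OF T0_norm[OF SV[OF True]]]) auto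
    also have "\<dots> = ((1 + \<Lambda> * \<delta>') - t * (1 + \<Lambda> * \<delta>')) * R"
      by (simp add: algebra_simps)
    also have "\<dots> = \<Lambda> * \<delta>' * R"
      unfolding t(3) by simp
    finally have "N (T0 (S n) - T (S n)) \<le> \<Lambda> * \<delta>' * R" .
    moreover have "T (S n) \<in> U"
      unfolding T_def by (rule subspace_scale[OF subspace_U T0S])
    ultimately show ?thesis
      using True T0_S[OF True] N_diff_triangle[OF \<xi>U[of n] T0S, of "T (S n)"]
      by (simp add: alpha_def algebra_simps)
  next
    case False
    then show ?thesis
      using \<xi> \<open>0 < \<delta>'\<close> \<Lambda>(1) R0 by (simp add: Vect_Gamma_def alpha_def)
  qed
  ultimately show ?thesis
    by blast
qed

text \<open>The linear map is the identity. Half of \<epsilon> is spent on the distance from \<xi>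
  to \<open>alpha S m T\<close>, which \<open>rho_V_le_const\<close> bounds by
  \<open>\<kappa> * \<rho> 1\<close>.\<close>

lemma normalized_dim_Vect_le_Hom:
  fixes \<rho> :: "(nat \<Rightarrow> 'k) \<Rightarrow> real"
  assumes \<rho>: "product_norm \<rho>" and "\<one> \<in> F"
    and near: "\<And>\<xi>. \<xi> \<in> Vect_Gamma sV sW act U N \<sigma> S F m \<delta>' \<Longrightarrow>
      \<exists>T\<in>Hom_Gamma sV sW act U N \<sigma> S F m \<delta>. \<forall>n. N (\<xi> n - alpha S m T n) \<le> \<kappa>"
    and \<kappa>: "\<kappa> * \<rho> 1 \<le> \<epsilon> / 2"
  shows "normalized_dim sW U N \<rho> \<epsilon> (Vect_Gamma sV sW act U N \<sigma> S F m \<delta>')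
    \<le> normalized_dim sW U N \<rho> (\<epsilon> / 2) (alpha S m ` Hom_Gamma sV sW act U N \<sigma> S F m \<delta>)"
proof (rule normalized_dim_le_linear[where L = "\<lambda>f. f"])
  interpret sS: vector_space "seq_scale sW"
    by (rule vector_space_seq_scale) (rule vector_space_axioms)
  fix \<xi> assume \<xi>: "\<xi> \<in> Vect_Gamma sV sW act U N \<sigma> S F m \<delta>'"
  then obtain T where T: "T \<in> Hom_Gamma sV sW act U N \<sigma> S F m \<delta>"
    "\<And>n. N (\<xi> n - alpha S m T n) \<le> \<kappa>"
    using near by blast
  have \<xi>e: "\<xi> \<in> ell_inf U N"
    using \<xi> subspace_0[OF subspace_U]
    by (intro ell_inf_finite_support[of _ m]) (auto simp: Vect_Gamma_def not_le[symmetric])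
  have Te: "alpha S m T \<in> ell_inf U N"
    using Hom_Gamma_in_U[OF T(1) \<open>\<one> \<in> F\<close>] subspace_0[OF subspace_U]
    by (intro ell_inf_finite_support[of _ m]) (auto simp: alpha_def)
  have "rho_V \<rho> N (\<xi> - w) < \<epsilon>" if w: "w \<in> ell_inf U N" "rho_V \<rho> N (alpha S m T - w) < \<epsilon> / 2" for w
  proof -
    have "rho_V \<rho> N (\<xi> - w) \<le> rho_V \<rho> N (\<xi> - alpha S m T) + rho_V \<rho> N (alpha S m T - w)"
      using rho_V_add[OF \<rho> sS.subspace_diff[OF subspace_ell_inf \<xi>e Te]
          sS.subspace_diff[OF subspace_ell_inf Te w(1)]] by simp
    moreover have "rho_V \<rho> N (\<xi> - alpha S m T) \<le> \<kappa> * \<rho> 1"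
      using T(2) by (intro rho_V_le_const[OF \<rho> sS.subspace_diff[OF subspace_ell_inf \<xi>e Te]]) simp
    ultimately show ?thesis
      using w(2) \<kappa> by simp
  qed
  then show "\<exists>y\<in>alpha S m ` Hom_Gamma sV sW act U N \<sigma> S F m \<delta>. \<forall>w\<in>ell_inf U N.
      rho_V \<rho> N (y - w) < \<epsilon> / 2 \<longrightarrow> rho_V \<rho> N (\<xi> - w) < \<epsilon>"
    using T(1) by blast
qed (simp add: linear_on_def subspace_ell_inf)

end

text \<open>In the product filter the conditions on \<open>F\<close>, \<open>m\<close> and \<delta>
  separate, so \<open>F\<close> and \<open>m\<close> can be frozen while \<delta> tends to 0. This
  is needed because \<open>Vect_Gamma\<close> and \<open>Hom_Gamma\<close> will be compared at the
  same \<open>F\<close> and \<open>m\<close> but at different \<delta>.\<close>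

lemma eventually_triples_shrink:
  assumes "eventually P (triples_at_top G)"
  shows "\<exists>F m. \<forall>e>0. \<exists>\<delta>>0. \<delta> < e \<and> P (F, m, \<delta>)"
proof -
  obtain A B where AB: "eventually A (finite_subsets_at_top (carrier G))"
    "eventually B (sequentially \<times>\<^sub>F at_right (0::real))" "\<And>F x. A F \<Longrightarrow> B x \<Longrightarrow> P (F, x)"
    using assms unfolding triples_at_top_def eventually_prod_filter by blast
  obtain D E where DE: "eventually D sequentially" "eventually E (at_right (0::real))"
    "\<And>m \<delta>. D m \<Longrightarrow> E \<delta> \<Longrightarrow> B (m, \<delta>)"
    using AB(2) unfolding eventually_prod_filter by blast
  obtain F where "A F"
    using eventually_happens'[OF finite_subsets_at_top_neq_bot AB(1)] by blast
  obtain m where "D m"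
    using eventually_happens'[OF sequentially_bot DE(1)] by blast
  have "\<exists>\<delta>>0. \<delta> < e \<and> P (F, m, \<delta>)" if "e > 0" for e
  proof -
    have "\<forall>\<^sub>F \<delta> in at_right 0. 0 < \<delta> \<and> \<delta> < e"
      using that by (auto simp: eventually_at_right_field)
    then have "\<forall>\<^sub>F \<delta> in at_right 0. 0 < \<delta> \<and> \<delta> < e \<and> E \<delta>"
      using DE(2) by eventually_elim simp
    then show ?thesis
      using eventually_happens'[OF trivial_limit_at_right_real[of 0]] AB(3) DE(3) \<open>A F\<close> \<open>D m\<close>
      by blast
  qed
  then show ?thesis
    by blast
qed

text \<open>If the lower limit exceeded the upper one, a number \<open>c\<close> strictly between
  them would eventually lie above \<open>a\<close> and below \<open>b\<close>. With \<open>F\<close>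
  and \<open>m\<close> frozen, first choose \<delta>, then \<delta>' below the threshold it
  determines; \<open>le\<close> then contradicts the position of \<open>c\<close>.\<close>

lemma vdim_Sigma_le_dim_Sigma:
  fixes G :: "('g, 'm) monoid_scheme" (structure)
    and sV :: "'k::{real_normed_field,euclidean_space} \<Rightarrow> 'v::banach \<Rightarrow> 'v"
    and sW :: "'k \<Rightarrow> 'w::ab_group_add \<Rightarrow> 'w"
    and \<rho> :: "(nat \<Rightarrow> 'k) \<Rightarrow> real"
  assumes act: "\<And>i. action_with_isometries G sV act sW (U i) (N i) (\<sigma> i)"
    and S: "dynamically_generating G sV act S" and \<rho>: "product_norm \<rho>"
  shows "vdim_Sigma G sV sW act U N \<sigma> S \<rho> \<le> dim_Sigma G sV sW act U N \<sigma> S \<rho>"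
proof -
  interpret V: uniformly_bounded_action G sV act
    using act by (rule action_with_isometries.axioms(1))
  interpret group G
    using V.group_hom by (rule group_hom.axioms(1))
  obtain C where C: "1 \<le> C" "\<And>w v. set w \<subseteq> carrier G \<Longrightarrow> norm (foldr act w v) \<le> C * norm v"
    using V.word_bounded by blast
  obtain R where R: "0 < R" "\<And>n. norm (S n) \<le> R"
    using S unfolding dynamically_generating_def bounded_pos by blast
  define a where "a = (\<lambda>\<epsilon> (F, m, \<delta>). limsup (\<lambda>i. normalized_dim sW (U i) (N i) \<rho> \<epsilon>
         (alpha S m ` Hom_Gamma sV sW act (U i) (N i) (\<sigma> i) S F m \<delta>)))"
  define b where "b = (\<lambda>\<epsilon> (F, m, \<delta>). limsup (\<lambda>i. normalized_dim sW (U i) (N i) \<rho> \<epsilon>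
         (Vect_Gamma sV sW act (U i) (N i) (\<sigma> i) S F m \<delta>)))"
  have le: "\<exists>\<delta>1>0. \<forall>\<delta>'. 0 < \<delta>' \<longrightarrow> \<delta>' < \<delta>1 \<longrightarrow> b \<epsilon> (F, m, \<delta>') \<le> a (\<epsilon> / 2) (F, m, \<delta>)"
    if F: "finite F" "F \<subseteq> carrier G" "\<one> \<in> F" and m: "2 \<le> m" and "0 < \<delta>" "0 < \<epsilon>" for F m \<delta> \<epsilon>
  proof -
    obtain \<beta> p where \<beta>: "finite \<beta>" "V.independent \<beta>" "V_span sV act S F m = V.span \<beta>"
      and p: "\<And>v. v \<in> \<beta> \<Longrightarrow> p v \<in> group_words F m \<times> {..<m}"
        "\<And>v. v \<in> \<beta> \<Longrightarrow> foldr act (fst (p v)) (S (snd (p v))) = v"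
      using V.V_span_basis[OF F(1), of S m] by metis
    obtain \<Lambda> where \<Lambda>: "\<Lambda> \<ge> 0"
      "\<And>c. (\<Sum>b\<in>\<beta>. norm (c b)) \<le> \<Lambda> * norm (\<Sum>b\<in>\<beta>. sV (c b) b)"
      using V.independent_coeff_bound[OF \<beta>(1,2)] by blast
    \<comment> \<open>\<open>E\<close> is the factor in the hypothesis on \<delta>' of
      \<open>Vect_Gamma_near_Hom\<close>. \<open>E'\<close> dominates the distance it yields,
      measured by \<rho>; the added 1 keeps \<open>E'\<close> positive using only
      \<open>0 \<le> \<rho> 1\<close>.\<close>
    define E where "E = \<Lambda> * (C * R) + \<Lambda> * R + 4"
    define E' where "E' = (2 * (\<Lambda> * R) + 3) * (\<rho> 1 + 1)"
    have \<rho>1: "0 \<le> \<rho> 1"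
      by (rule product_norm_nonneg[OF \<rho>]) (auto simp: ell_inf_def)
    have E: "0 < E" "0 < E'"
      using \<Lambda>(1) C(1) R(1) \<rho>1 by (simp_all add: E_def E'_def add_nonneg_pos)
    show ?thesis
    proof (intro exI[of _ "min (\<delta> / E) (\<epsilon> / 2 / E')"] conjI allI impI)
      show "0 < min (\<delta> / E) (\<epsilon> / 2 / E')"
        using E \<open>0 < \<delta>\<close> \<open>0 < \<epsilon>\<close> by simp
      fix \<delta>' assume "0 < \<delta>'" "\<delta>' < min (\<delta> / E) (\<epsilon> / 2 / E')"
      then have \<delta>': "\<delta>' * E < \<delta>" "\<delta>' * E' < \<epsilon> / 2"
        using E by (simp_all add: pos_less_divide_eq)
      have "\<delta>' * (2 * (\<Lambda> * R) + 3) * \<rho> 1 \<le> \<delta>' * E'"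
        unfolding E'_def mult.assoc using \<open>0 < \<delta>'\<close> \<Lambda>(1) R(1) by (simp add: mult_left_mono)
      then have \<kappa>: "\<delta>' * (2 * (\<Lambda> * R) + 3) * \<rho> 1 \<le> \<epsilon> / 2"
        using \<delta>'(2) by simp
      show "b \<epsilon> (F, m, \<delta>') \<le> a (\<epsilon> / 2) (F, m, \<delta>)"
        unfolding a_def b_def prod.case
      proof (intro Limsup_mono always_eventually allI)
        fix i
        interpret W: action_with_isometries G sV act sW "U i" "N i" "\<sigma> i"
          by (rule act)
        show "normalized_dim sW (U i) (N i) \<rho> \<epsilon> (Vect_Gamma sV sW act (U i) (N i) (\<sigma> i) S F m \<delta>')
          \<le> normalized_dim sW (U i) (N i) \<rho> (\<epsilon> / 2)
            (alpha S m ` Hom_Gamma sV sW act (U i) (N i) (\<sigma> i) S F m \<delta>)"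
          by (rule W.normalized_dim_Vect_le_Hom[OF \<rho> F(3) _ \<kappa>],
              rule W.Vect_Gamma_near_Hom[OF _ \<open>0 < \<delta>'\<close> F m \<beta> p \<Lambda> C R(2) \<delta>'(1)[unfolded E_def]])
      qed
    qed
  qed
  have "Liminf (triples_at_top G) (b \<epsilon>) \<le> Limsup (triples_at_top G) (a (\<epsilon> / 2))" if "0 < \<epsilon>" for \<epsilon>
  proof (rule ccontr)
    assume "\<not> ?thesis"
    then obtain c where c: "Limsup (triples_at_top G) (a (\<epsilon> / 2)) < c"
      "c < Liminf (triples_at_top G) (b \<epsilon>)"
      using dense not_le by metis
    have "\<forall>\<^sub>F t in triples_at_top G. a (\<epsilon> / 2) t < c \<and> c < b \<epsilon> t \<and>
      (case t of (F, m, \<delta>) \<Rightarrow> finite F \<and> F \<subseteq> carrier G \<and> {\<one>} \<subseteq> F \<and> 2 \<le> m \<and> 0 < \<delta> \<and> \<delta> < 1)"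
      by (intro eventually_conj Limsup_lessD[OF c(1)] less_LiminfD[OF c(2)] eventually_triples) auto
    from eventually_triples_shrink[OF this] obtain F m where
      "\<forall>e>0. \<exists>\<delta>>0. \<delta> < e \<and> a (\<epsilon> / 2) (F, m, \<delta>) < c \<and> c < b \<epsilon> (F, m, \<delta>)
        \<and> finite F \<and> F \<subseteq> carrier G \<and> {\<one>} \<subseteq> F \<and> 2 \<le> m \<and> 0 < \<delta> \<and> \<delta> < 1"
      unfolding prod.case by (elim exE)
    then have Fm: "\<exists>\<delta>>0. \<delta> < e \<and> a (\<epsilon> / 2) (F, m, \<delta>) < c \<and> c < b \<epsilon> (F, m, \<delta>)
        \<and> finite F \<and> F \<subseteq> carrier G \<and> \<one> \<in> F \<and> 2 \<le> m" if "e > 0" for e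
      using that by (meson insert_subset)
    obtain \<delta> where \<delta>: "\<delta> > 0" "a (\<epsilon> / 2) (F, m, \<delta>) < c"
      and F: "finite F" "F \<subseteq> carrier G" "\<one> \<in> F" "2 \<le> m"
      using Fm[OF zero_less_one] by blast
    obtain \<delta>1 where \<delta>1: "\<delta>1 > 0"
      "\<And>\<delta>'. 0 < \<delta>' \<Longrightarrow> \<delta>' < \<delta>1 \<Longrightarrow> b \<epsilon> (F, m, \<delta>') \<le> a (\<epsilon> / 2) (F, m, \<delta>)"
      using le[OF F \<delta>(1) \<open>0 < \<epsilon>\<close>] by blast
    obtain \<delta>' where "0 < \<delta>'" "\<delta>' < \<delta>1" "c < b \<epsilon> (F, m, \<delta>')"
      using Fm[OF \<delta>1(1)] by blast
    then show False
      using \<delta>1(2)[of \<delta>'] \<delta>(2) by simp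
  qed
  then have "\<exists>\<epsilon>'\<in>{0<..}. Liminf (triples_at_top G) (b \<epsilon>) \<le> Limsup (triples_at_top G) (a \<epsilon>')"
    if "\<epsilon> \<in> {0<..}" for \<epsilon>
    using that by (intro bexI[of _ "\<epsilon> / 2"]) auto
  then show ?thesis
    unfolding dim_Sigma_def vdim_Sigma_def a_def b_def by (rule SUP_mono)
qed

theorem proposition4p3:
  fixes G :: "('g, 'm) monoid_scheme"
    and sV :: "'k::{real_normed_field,euclidean_space} \<Rightarrow> 'v::banach \<Rightarrow> 'v"
    and sW :: "'k \<Rightarrow> 'w::ab_group_add \<Rightarrow> 'w"
    and act :: "'g \<Rightarrow> 'v \<Rightarrow> 'v"
    and U :: "nat \<Rightarrow> 'w set" and N :: "nat \<Rightarrow> 'w \<Rightarrow> real"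
    and \<sigma> :: "nat \<Rightarrow> 'g \<Rightarrow> 'w \<Rightarrow> 'w"
    and S S' :: "nat \<Rightarrow> 'v" and \<rho> \<rho>' :: "(nat \<Rightarrow> 'k) \<Rightarrow> real"
  assumes "uniformly_bounded_action G sV act"
    and "\<And>i. fd_normed_space sW (U i) (N i)"
    and "\<And>i g. g \<in> carrier G \<Longrightarrow> surj_isometry sW (U i) (N i) (\<sigma> i g)"
    and "dynamically_generating G sV act S'" and "product_norm \<rho>'"
    and "dynamically_generating G sV act S" and "product_norm \<rho>"
  shows "dim_Sigma G sV sW act U N \<sigma> S' \<rho>' = vdim_Sigma G sV sW act U N \<sigma> S \<rho>"
proof (rule antisym)
  have act: "action_with_isometries G sV act sW (U i) (N i) (\<sigma> i)" for i
    using assms(1-3)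
    by (intro action_with_isometries.intro action_with_isometries_axioms.intro)
  show "dim_Sigma G sV sW act U N \<sigma> S' \<rho>' \<le> vdim_Sigma G sV sW act U N \<sigma> S \<rho>"
    by (rule dim_Sigma_le_vdim_Sigma[OF act assms(4-7)])
  have "vdim_Sigma G sV sW act U N \<sigma> S \<rho> \<le> dim_Sigma G sV sW act U N \<sigma> S \<rho>"
    by (rule vdim_Sigma_le_dim_Sigma[OF act assms(6,7)])
  also have "\<dots> \<le> vdim_Sigma G sV sW act U N \<sigma> S' \<rho>'"
    by (rule dim_Sigma_le_vdim_Sigma[OF act assms(6,7,4,5)])
  also have "\<dots> \<le> dim_Sigma G sV sW act U N \<sigma> S' \<rho>'"
    by (rule vdim_Sigma_le_dim_Sigma[OF act assms(4,5)])
  finally show "vdim_Sigma G sV sW act U N \<sigma> S \<rho> \<le> dim_Sigma G sV sW act U N \<sigma> S' \<rho>'" .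
qed

end
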